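(* Let $n\ge 2$, let $\Omega\subset\mathbb{R}^n$ be open and bounded, $\mathcal{H}=L^2(\Omega,\mathbb{R}^n)$, and $$J(u):=\int_\Omega|\mathrm{div}\,u|:=\sup\Big\{-\int_\Omega u\cdot\nabla v\,\mathrm{d}x : v\in C_c^\infty(\Omega,[-1,1])\Big\},\quad u\in L^2(\Omega,\mathbb{R}^n).$$ Then the gradient flow $\partial_tu(t)=-p(t)$, $p(t)\in\partial J(u(t))$ with $u(0)=f$ generates a sequence of eigenvectors $p(t)$ for $t>0$, i.e. $p(t)\in\partial J(p(t))$ for all $t>0$.
   Context: The subdifferential is $\partial J(u)=\{p\in\mathcal{H}:\langle p,v\rangle\le J(v)\ \forall v\in\mathcal{H},\ \langle p,u\rangle=J(u)\}$, with $\langle\cdot,\cdot\rangle$ the $L^2$ inner product, and $\mathrm{dom}(\partial J)=\{u:\partial J(u)\ne\emptyset\}$. $C_c^\infty(\Omega,[-1,1])$ is the set of smooth compactly supported functions on $\Omega$ with values in $[-1,1]$. Gradient flow: for $f\in\overline{\mathrm{dom}(\partial J)}$, the solution $(u,p)$ of $\partial_tu(t)=-p(t)$, $p(t)\in\partial J(u(t))$, $u(0)=f$ is the unique continuous $u:[0,\infty)\to\mathcal{H}$ with $u(0)=f$ given by Brezis' theory (Lipschitz on $[\delta,\infty)$ for every $\delta>0$, $u(t)\in\mathrm{dom}(\partial J)$ for all $t>0$, right-differentiable at every $t>0$), together with $p(t):=-\partial_t^+u(t)$, which is the element of minimal norm in $\partial J(u(t))$ for every $t>0$. *)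

theory Defs
  imports "HOL-Analysis.Analysis"
begin

text \<open>
  Elements of \<open>L\<^sup>2(\<Omega>, \<real>\<^sup>n)\<close> are represented by functions on the whole space, of which only the
  restriction to \<open>\<Omega>\<close> matters. No quotient by equality almost everywhere is formed: every notion
  below depends on the representatives only up to null sets of \<open>\<Omega>\<close>.
\<close>

type_synonym 'n field = "real ^ 'n \<Rightarrow> real ^ 'n"

definition L2 :: "(real ^ 'n::finite) set \<Rightarrow> 'n field set" where
  "L2 \<Omega> = {u. u \<in> borel_measurable (lebesgue_on \<Omega>) \<and>
               integrable (lebesgue_on \<Omega>) (\<lambda>x. (norm (u x))\<^sup>2)}"

definition L2_inner :: "(real ^ 'n::finite) set \<Rightarrow> 'n field \<Rightarrow> 'n field \<Rightarrow> real" where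
  "L2_inner \<Omega> u v = (\<integral>x. u x \<bullet> v x \<partial>lebesgue_on \<Omega>)"

definition L2_norm :: "(real ^ 'n::finite) set \<Rightarrow> 'n field \<Rightarrow> real" where
  "L2_norm \<Omega> u = sqrt (L2_inner \<Omega> u u)"

definition L2_dist :: "(real ^ 'n::finite) set \<Rightarrow> 'n field \<Rightarrow> 'n field \<Rightarrow> real" where
  "L2_dist \<Omega> u v = L2_norm \<Omega> (\<lambda>x. u x - v x)"

definition L2_closure :: "(real ^ 'n::finite) set \<Rightarrow> 'n field set \<Rightarrow> 'n field set" where
  "L2_closure \<Omega> S = {f \<in> L2 \<Omega>. \<forall>\<epsilon>>0. \<exists>g\<in>S. L2_dist \<Omega> f g < \<epsilon>}"

definition partial_deriv :: "'a::euclidean_space \<Rightarrow> ('a \<Rightarrow> real) \<Rightarrow> 'a \<Rightarrow> real" where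
  "partial_deriv i v x = frechet_derivative v (at x) i"

fun Ck :: "nat \<Rightarrow> ('a::euclidean_space \<Rightarrow> real) \<Rightarrow> bool" where
  "Ck 0 v = continuous_on UNIV v"
| "Ck (Suc k) v = ((\<forall>x. v differentiable (at x)) \<and> (\<forall>i\<in>Basis. Ck k (partial_deriv i v)))"

definition grad :: "('a::euclidean_space \<Rightarrow> real) \<Rightarrow> 'a \<Rightarrow> 'a" where
  "grad v x = (\<Sum>i\<in>Basis. partial_deriv i v x *\<^sub>R i)"

text \<open>
  The set \<open>C\<^sub>c\<^sup>\<infinity>(\<Omega>, [-1,1])\<close>, its elements being extended by zero to the whole space. As the
  support is a compact subset of the open set \<open>\<Omega>\<close>, smoothness on \<open>\<Omega>\<close> and smoothness of the
  extension are the same.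
\<close>

definition test_functions :: "'a::euclidean_space set \<Rightarrow> ('a \<Rightarrow> real) set" where
  "test_functions \<Omega> = {v. (\<forall>k. Ck k v) \<and> compact (closure {x. v x \<noteq> 0}) \<and>
                          closure {x. v x \<noteq> 0} \<subseteq> \<Omega> \<and> range v \<subseteq> {-1..1}}"

text \<open>The functional \<open>J(u) = \<integral>\<^sub>\<Omega> |div u|\<close>, which may take the value \<open>\<infinity>\<close>.\<close>

definition total_div :: "(real ^ 'n::finite) set \<Rightarrow> 'n field \<Rightarrow> ereal" where
  "total_div \<Omega> u =
     (SUP v \<in> test_functions \<Omega>. ereal (- (\<integral>x. u x \<bullet> grad v x \<partial>lebesgue_on \<Omega>)))"

text \<open>This form of the subdifferential is the one for absolutely one-homogeneous functionals.\<close>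

definition subdiff ::
    "(real ^ 'n::finite) set \<Rightarrow> ('n field \<Rightarrow> ereal) \<Rightarrow> 'n field \<Rightarrow> 'n field set" where
  "subdiff \<Omega> J u =
     {p \<in> L2 \<Omega>. (\<forall>v\<in>L2 \<Omega>. ereal (L2_inner \<Omega> p v) \<le> J v) \<and> ereal (L2_inner \<Omega> p u) = J u}"

definition dom_subdiff ::
    "(real ^ 'n::finite) set \<Rightarrow> ('n field \<Rightarrow> ereal) \<Rightarrow> 'n field set" where
  "dom_subdiff \<Omega> J = {u \<in> L2 \<Omega>. subdiff \<Omega> J u \<noteq> {}}"

text \<open>
  \<open>(u, p)\<close> is the solution in the sense of Brezis of
  \<open>\<partial>\<^sub>t u(t) = - p(t)\<close>, \<open>p(t) \<in> \<partial>J(u(t))\<close>, \<open>u(0) = f\<close>: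
  \<open>u\<close> is continuous on \<open>[0,\<infinity>)\<close>, Lipschitz on every \<open>[\<delta>,\<infinity>)\<close>, and for every \<open>t > 0\<close>
  the right derivative of \<open>u\<close> at \<open>t\<close> exists in \<open>L\<^sup>2\<close> and equals \<open>- p(t)\<close>, where \<open>p(t)\<close> is the
  element of minimal norm of \<open>\<partial>J(u(t))\<close>. Values at negative times are irrelevant, as is \<open>p(0)\<close>.
\<close>

definition gradient_flow ::
    "(real ^ 'n::finite) set \<Rightarrow> ('n field \<Rightarrow> ereal) \<Rightarrow> 'n field \<Rightarrow>
     (real \<Rightarrow> 'n field) \<Rightarrow> (real \<Rightarrow> 'n field) \<Rightarrow> bool" where
  "gradient_flow \<Omega> J f u p \<longleftrightarrow>
     (\<forall>t\<ge>0. u t \<in> L2 \<Omega>) \<and>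
     (AE x in lebesgue_on \<Omega>. u 0 x = f x) \<and>
     (\<forall>t\<ge>0. ((\<lambda>s. L2_dist \<Omega> (u s) (u t)) \<longlongrightarrow> 0) (at t within {0..})) \<and>
     (\<forall>\<delta>>0. \<exists>C. \<forall>s\<ge>\<delta>. \<forall>t\<ge>\<delta>. L2_dist \<Omega> (u s) (u t) \<le> C * \<bar>s - t\<bar>) \<and>
     (\<forall>t>0. u t \<in> dom_subdiff \<Omega> J) \<and>
     (\<forall>t>0. ((\<lambda>h. L2_dist \<Omega> (\<lambda>x. (u (t + h) x - u t x) /\<^sub>R h) (\<lambda>x. - p t x)) \<longlongrightarrow> 0)
              (at_right 0)) \<and>
     (\<forall>t>0. p t \<in> subdiff \<Omega> J (u t) \<and>
            (\<forall>q\<in>subdiff \<Omega> J (u t). L2_norm \<Omega> (p t) \<le> L2_norm \<Omega> q))"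

end

theory Submission
  imports Defs
begin

text \<open>
  Along the flow \<open>p(t)\<close> is the element of minimal norm of \<open>\<partial>J(u(t))\<close>, and for this functional the element
  \<open>p\<close> of minimal norm of any \<open>\<partial>J(u)\<close> is an eigenvector (\<open>minimal_norm_subgradient_is_eigenvector\<close>).

  The functional \<open>J\<close> is the support function of the set of gradients \<open>\<nabla>v\<close> of test functions \<open>v\<close>. Hence
  an element \<open>p\<close> of \<open>\<partial>J(u) \<subseteq> \<partial>J(0)\<close> is an \<open>L\<^sup>2\<close> limit of gradients \<open>\<nabla>v\<^sub>k\<close>, and by the Poincare inequality the
  \<open>v\<^sub>k\<close> converge almost everywhere to some \<open>V\<close> with \<open>|V| \<le> 1\<close> (\<open>dual_ball_approximation\<close>). Informally
  \<open>p = \<nabla>V\<close>, with \<open>V = 1\<close> and \<open>V = -1\<close> on the two parts of the support of \<open>div u\<close>, up to orientation.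

  If \<open>|\<phi>| \<le> 1 - |V|\<close>, then \<open>V \<plusminus> \<phi>\<close> keeps its values in \<open>[-1,1]\<close>. As \<open>V\<close> maximises the pairing of its gradient
  with \<open>u\<close>, the perturbation leaves that pairing unchanged, so \<open>p + t \<nabla>\<phi>\<close> stays in \<open>\<partial>J(u)\<close>, and minimality of
  the norm gives \<open>\<langle>p, \<nabla>\<phi>\<rangle> = 0\<close> (\<open>minimal_norm_orthogonality\<close>): \<open>V\<close> is harmonic off the set \<open>{|V| = 1}\<close>.

  To test this against an arbitrary test function \<open>w\<close>, cut \<open>w\<close> off near \<open>{|V| = 1}\<close> by means of an even power
  and take \<open>\<phi> = w (1 - V\<^sup>N) / N\<close>. The result is
  \<open>\<langle>p, \<nabla>w\<rangle> = \<integral> V\<^sup>N p \<bullet> \<nabla>w + N \<integral> w V\<^sup>N\<^sup>-\<^sup>1 |p|\<^sup>2\<close> (\<open>minimal_norm_variation\<close>).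
  For \<open>w = V\<close> it reads \<open>(N + 1) \<integral> V\<^sup>N |p|\<^sup>2 = \<parallel>p\<parallel>\<^sup>2\<close>. For general \<open>w\<close> the first integral equals
  \<open>-1/(N+1) \<integral> V\<^sup>N\<^sup>+\<^sup>1 \<Delta>w\<close> and tends to 0 (\<open>integral_power_grad_bound\<close>), while \<open>2 w V \<le> 1 + V\<^sup>2\<close> bounds the second
  term by \<open>N/2 \<integral> (V\<^sup>N\<^sup>-\<^sup>2 + V\<^sup>N) |p|\<^sup>2 = N/2 (1/(N-1) + 1/(N+1)) \<parallel>p\<parallel>\<^sup>2\<close>, which tends to \<open>\<parallel>p\<parallel>\<^sup>2\<close>. So
  \<open>\<langle>p, \<nabla>w\<rangle> \<le> \<parallel>p\<parallel>\<^sup>2\<close> for every \<open>w\<close>, that is \<open>J(p) \<le> \<parallel>p\<parallel>\<^sup>2\<close>, and the reverse inequality holds because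
  \<open>p\<close> lies in \<open>\<partial>J(0)\<close>.

  Cutting off with powers of \<open>V\<close> keeps all approximations smooth, so neither weak derivatives nor
  truncations of Sobolev functions appear.
\<close>

section \<open>Square integrable functions and mean square convergence\<close>

definition square_integrable :: "'b measure \<Rightarrow> ('b \<Rightarrow> 'a::euclidean_space) \<Rightarrow> bool" where
  "square_integrable M f \<longleftrightarrow> f \<in> borel_measurable M \<and> integrable M (\<lambda>x. (norm (f x))\<^sup>2)"

text \<open>
  This is \<open>L2_inner\<close> over an arbitrary measure and for values in an arbitrary Euclidean space, since
  scalar potentials are treated alongside vector fields.
\<close>

definition ip :: "'b measure \<Rightarrow> ('b \<Rightarrow> 'a::euclidean_space) \<Rightarrow> ('b \<Rightarrow> 'a) \<Rightarrow> real" where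
  "ip M f g = (\<integral>x. f x \<bullet> g x \<partial>M)"

definition L2_tendsto ::
    "'b measure \<Rightarrow> (nat \<Rightarrow> 'b \<Rightarrow> 'a::euclidean_space) \<Rightarrow> ('b \<Rightarrow> 'a) \<Rightarrow> bool" where
  "L2_tendsto M F f \<longleftrightarrow> (\<forall>k. square_integrable M (F k)) \<and> square_integrable M f \<and>
     (\<lambda>k. ip M (\<lambda>x. F k x - f x) (\<lambda>x. F k x - f x)) \<longlonglongrightarrow> 0"

lemma square_integrable_measurable [measurable_dest, dest]:
  "square_integrable M f \<Longrightarrow> f \<in> borel_measurable M"
  by (simp add: square_integrable_def)

lemma integrable_inner_L2:
  assumes "square_integrable M f" "square_integrable M g"
  shows "integrable M (\<lambda>x. f x \<bullet> g x)"
proof (rule Bochner_Integration.integrable_bound)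
  show "integrable M (\<lambda>x. (norm (f x))\<^sup>2 + (norm (g x))\<^sup>2)"
    using assms by (auto simp: square_integrable_def)
  show "(\<lambda>x. f x \<bullet> g x) \<in> borel_measurable M"
    using assms by (auto simp: square_integrable_def)
  have "\<bar>a \<bullet> b\<bar> \<le> (norm a)\<^sup>2 + (norm b)\<^sup>2" for a b :: 'b
  proof -
    have "\<bar>a \<bullet> b\<bar> \<le> norm a * norm b" by (rule Cauchy_Schwarz_ineq2)
    also have "\<dots> \<le> 2 * (norm a * norm b)" by simp
    also have "\<dots> \<le> (norm a)\<^sup>2 + (norm b)\<^sup>2"
      using sum_squares_bound[of "norm a" "norm b"] by simp
    finally show ?thesis .
  qed
  then show "AE x in M. norm (f x \<bullet> g x) \<le> norm ((norm (f x))\<^sup>2 + (norm (g x))\<^sup>2)"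
    by (simp add: order_trans[OF _ abs_ge_self])
qed

lemma square_integrable_add [simp]:
  assumes "square_integrable M f" "square_integrable M g"
  shows "square_integrable M (\<lambda>x. f x + g x)"
proof -
  have "integrable M (\<lambda>x. (norm (f x))\<^sup>2 + 2 * (f x \<bullet> g x) + (norm (g x))\<^sup>2)"
    using assms integrable_inner_L2[OF assms] by (auto simp: square_integrable_def)
  moreover have "(norm (a + b))\<^sup>2 = (norm a)\<^sup>2 + 2 * (a \<bullet> b) + (norm b)\<^sup>2" for a b :: 'b
    by (simp add: power2_norm_eq_inner algebra_simps inner_commute)
  moreover have "(\<lambda>x. f x + g x) \<in> borel_measurable M" using assms by measurable
  ultimately show ?thesis by (simp add: square_integrable_def)
qed

lemma square_integrable_scaleR [simp]:
  assumes "square_integrable M f"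
  shows "square_integrable M (\<lambda>x. c *\<^sub>R f x)"
  using assms by (auto simp: square_integrable_def power_mult_distrib)

lemma square_integrable_diff [simp]:
  assumes "square_integrable M f" "square_integrable M g"
  shows "square_integrable M (\<lambda>x. f x - g x)"
  using square_integrable_add[OF assms(1) square_integrable_scaleR[OF assms(2), of "-1"]] by simp

lemma square_integrable_zero [simp]: "square_integrable M (\<lambda>_. 0)"
  by (simp add: square_integrable_def)

lemma ip_commute: "ip M f g = ip M g f"
  by (simp add: ip_def inner_commute)

lemma ip_add_left:
  assumes "square_integrable M f" "square_integrable M g" "square_integrable M h"
  shows "ip M (\<lambda>x. f x + g x) h = ip M f h + ip M g h"
  using assms by (simp add: ip_def inner_add_left integrable_inner_L2)

lemma ip_diff_left:
  assumes "square_integrable M f" "square_integrable M g" "square_integrable M h"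
  shows "ip M (\<lambda>x. f x - g x) h = ip M f h - ip M g h"
  using assms by (simp add: ip_def inner_diff_left integrable_inner_L2)

lemma ip_scaleR_left: "ip M (\<lambda>x. c *\<^sub>R f x) h = c * ip M f h"
  by (simp add: ip_def)

lemma ip_add_right:
  assumes "square_integrable M f" "square_integrable M g" "square_integrable M h"
  shows "ip M h (\<lambda>x. f x + g x) = ip M h f + ip M h g"
  using ip_add_left[OF assms] by (simp add: ip_commute)

lemma ip_diff_right:
  assumes "square_integrable M f" "square_integrable M g" "square_integrable M h"
  shows "ip M h (\<lambda>x. f x - g x) = ip M h f - ip M h g"
  using ip_diff_left[OF assms] by (simp add: ip_commute)

lemma ip_scaleR_right: "ip M h (\<lambda>x. c *\<^sub>R f x) = c * ip M h f"
  by (simp add: ip_def)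

lemma ip_self_nonneg [simp]: "0 \<le> ip M f f"
  by (simp add: ip_def)

lemmas ip_algebra = ip_add_left ip_add_right ip_diff_left ip_diff_right
  ip_scaleR_left ip_scaleR_right

lemma ip_add_scaleR_self:
  assumes "square_integrable M f" "square_integrable M g"
  shows "ip M (\<lambda>x. f x + t *\<^sub>R g x) (\<lambda>x. f x + t *\<^sub>R g x)
    = ip M f f + 2 * t * ip M f g + t\<^sup>2 * ip M g g"
  using assms
  by (simp add: ip_algebra square_integrable_add square_integrable_scaleR ip_commute[of M g f]
      power2_eq_square algebra_simps)

text \<open>Nonnegativity of the quadratic polynomial \<open>t \<mapsto> \<parallel>f + t g\<parallel>\<^sup>2\<close>.\<close>

lemma ip_Cauchy_Schwarz:
  assumes f: "square_integrable M f" and g: "square_integrable M g"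
  shows "\<bar>ip M f g\<bar> \<le> sqrt (ip M f f) * sqrt (ip M g g)"
proof -
  let ?a = "ip M f f" and ?b = "ip M f g" and ?c = "ip M g g"
  have q: "0 \<le> ?a + 2 * t * ?b + t\<^sup>2 * ?c" for t
    using ip_self_nonneg[of M "\<lambda>x. f x + t *\<^sub>R g x"] ip_add_scaleR_self[OF assms, of t] by simp
  have "?b\<^sup>2 \<le> ?a * ?c"
  proof (cases "?c = 0")
    case True
    have "?b = 0"
    proof (rule ccontr)
      assume "?b \<noteq> 0"
      have "0 \<le> ?a + 2 * (- (?a + 1) / (2 * ?b)) * ?b"
        using q[of "- (?a + 1) / (2 * ?b)"] True by simp
      also have "\<dots> = -1" using \<open>?b \<noteq> 0\<close> by (simp add: field_simps)
      finally show False by simp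
    qed
    then show ?thesis using True by simp
  next
    case False
    then have "?c > 0" using ip_self_nonneg[of M g] by linarith
    then show ?thesis using q[of "- ?b / ?c"] False
      by (simp add: field_simps power2_eq_square)
  qed
  then have "sqrt (?b\<^sup>2) \<le> sqrt (?a * ?c)" by (rule real_sqrt_le_mono)
  then show ?thesis by (simp add: real_sqrt_mult)
qed

text \<open>
  Expand \<open>\<langle>f\<^sub>k, h\<^sub>k\<rangle> - \<langle>f, h\<rangle>\<close> around the limits and bound each term by the Cauchy-Schwarz inequality.
\<close>

lemma L2_tendsto_ip:
  assumes "L2_tendsto M F f" "L2_tendsto M H h"
  shows "(\<lambda>k. ip M (F k) (H k)) \<longlonglongrightarrow> ip M f h"
proof -
  note [simp] = assms[unfolded L2_tendsto_def]
  let ?d = "\<lambda>k x. F k x - f x" and ?e = "\<lambda>k x. H k x - h x"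
  have si: "square_integrable M (?d k)" "square_integrable M (?e k)" for k
    by (auto intro!: square_integrable_diff)
  have d0: "(\<lambda>k. sqrt (ip M (?d k) (?d k))) \<longlonglongrightarrow> 0" and e0: "(\<lambda>k. sqrt (ip M (?e k) (?e k))) \<longlonglongrightarrow> 0"
    using assms tendsto_real_sqrt[of "\<lambda>k. ip M (?d k) (?d k)" 0 sequentially]
      tendsto_real_sqrt[of "\<lambda>k. ip M (?e k) (?e k)" 0 sequentially]
    by (simp_all add: L2_tendsto_def)
  have *: "(\<lambda>k. ip M (a k) (b k)) \<longlonglongrightarrow> 0"
    if "\<And>k. square_integrable M (a k)" "\<And>k. square_integrable M (b k)"
      "(\<lambda>k. sqrt (ip M (a k) (a k)) * sqrt (ip M (b k) (b k))) \<longlonglongrightarrow> 0" for a b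
    by (rule Lim_null_comparison[OF always_eventually that(3)])
      (auto intro!: ip_Cauchy_Schwarz that)
  have "(\<lambda>k. ip M (?d k) (?e k) + ip M f (?e k) + ip M (?d k) h + ip M f h)
      \<longlonglongrightarrow> 0 + 0 + 0 + ip M f h"
    by (intro tendsto_add tendsto_const *) 
      (auto intro!: si tendsto_mult_zero[OF d0 e0] tendsto_mult_right_zero e0
        tendsto_mult_left_zero d0)
  moreover have "ip M (?d k) (?e k) + ip M f (?e k) + ip M (?d k) h + ip M f h = ip M (F k) (H k)" for k
    by (simp add: ip_algebra square_integrable_diff)
  ultimately show ?thesis by simp
qed

lemma L2_tendsto_const: "square_integrable M f \<Longrightarrow> L2_tendsto M (\<lambda>_. f) f"
  by (simp add: L2_tendsto_def ip_def)

lemma L2_tendsto_scaleR: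
  assumes "L2_tendsto M F f"
  shows "L2_tendsto M (\<lambda>k x. c *\<^sub>R F k x) (\<lambda>x. c *\<^sub>R f x)"
proof -
  have "ip M (\<lambda>x. c *\<^sub>R F k x - c *\<^sub>R f x) (\<lambda>x. c *\<^sub>R F k x - c *\<^sub>R f x)
      = c\<^sup>2 * ip M (\<lambda>x. F k x - f x) (\<lambda>x. F k x - f x)" for k
    by (simp add: scaleR_diff_right[symmetric] ip_scaleR_left ip_scaleR_right power2_eq_square
        del: scaleR_diff_right)
  then show ?thesis using assms
    by (auto simp: L2_tendsto_def intro!: tendsto_mult_right_zero)
qed

lemma L2_tendsto_add:
  assumes "L2_tendsto M F f" "L2_tendsto M H h"
  shows "L2_tendsto M (\<lambda>k x. F k x + H k x) (\<lambda>x. f x + h x)"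
proof -
  note si [simp] = assms[unfolded L2_tendsto_def]
  let ?d = "\<lambda>k x. F k x - f x" and ?e = "\<lambda>k x. H k x - h x"
  have d: "square_integrable M (?d k)" "square_integrable M (?e k)" for k
    using si by (auto intro!: square_integrable_diff)
  have "L2_tendsto M ?d (\<lambda>_. 0)" "L2_tendsto M ?e (\<lambda>_. 0)"
    using si d by (auto simp: L2_tendsto_def)
  then have "(\<lambda>k. ip M (?d k) (?e k)) \<longlonglongrightarrow> 0" 
    using L2_tendsto_ip by (fastforce simp: ip_def)
  then have "(\<lambda>k. ip M (?d k) (?d k) + 2 * 1 * ip M (?d k) (?e k) + 1\<^sup>2 * ip M (?e k) (?e k)) \<longlonglongrightarrow> 0 + 2 * 1 * 0 + 1\<^sup>2 * 0"
    using si by (intro tendsto_intros) auto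
  moreover have "ip M (?d k) (?d k) + 2 * 1 * ip M (?d k) (?e k) + 1\<^sup>2 * ip M (?e k) (?e k)
    = ip M (\<lambda>x. (F k x + H k x) - (f x + h x)) (\<lambda>x. (F k x + H k x) - (f x + h x))" for k
    unfolding ip_add_scaleR_self[OF d, symmetric] by (simp add: algebra_simps)
  ultimately show ?thesis using si
    by (auto simp: L2_tendsto_def)
qed

lemma square_integrable_bounded_scaleR:
  fixes a :: "'b \<Rightarrow> real"
  assumes "a \<in> borel_measurable M" "AE x in M. \<bar>a x\<bar> \<le> B" "square_integrable M f"
  shows "square_integrable M (\<lambda>x. a x *\<^sub>R f x)"
  unfolding square_integrable_def
proof
  show "(\<lambda>x. a x *\<^sub>R f x) \<in> borel_measurable M" using assms by measurable
  show "integrable M (\<lambda>x. (norm (a x *\<^sub>R f x))\<^sup>2)"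
  proof (rule Bochner_Integration.integrable_bound)
    show "integrable M (\<lambda>x. B\<^sup>2 * (norm (f x))\<^sup>2)"
      using assms by (auto simp: square_integrable_def)
    show "(\<lambda>x. (norm (a x *\<^sub>R f x))\<^sup>2) \<in> borel_measurable M" using assms by measurable
    show "AE x in M. norm ((norm (a x *\<^sub>R f x))\<^sup>2) \<le> norm (B\<^sup>2 * (norm (f x))\<^sup>2)"
      using assms(2)
    proof eventually_elim
      case (elim x)
      then have "\<bar>a x\<bar>\<^sup>2 \<le> B\<^sup>2" by (intro power_mono) auto
      then show ?case by (simp add: power_mult_distrib mult_right_mono)
    qed
  qed
qed

text \<open>
  The difference splits into \<open>a\<^sub>k (f\<^sub>k - f)\<close>, which is small because the factors are bounded, and
  \<open>(a\<^sub>k - a) f\<close>, which is small by dominated convergence. This is what makes products of powers of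
  converging potentials with converging gradients pass to the limit.
\<close>

lemma L2_tendsto_bounded_scaleR:
  fixes A :: "nat \<Rightarrow> 'b \<Rightarrow> real"
  assumes F: "L2_tendsto M F f"
    and A: "\<And>k. A k \<in> borel_measurable M" and a: "a \<in> borel_measurable M"
    and bd: "\<And>k. AE x in M. \<bar>A k x\<bar> \<le> B"
    and lim: "AE x in M. (\<lambda>k. A k x) \<longlonglongrightarrow> a x"
  shows "L2_tendsto M (\<lambda>k x. A k x *\<^sub>R F k x) (\<lambda>x. a x *\<^sub>R f x)"
proof -
  note si [simp] = F[unfolded L2_tendsto_def]
  have bdA: "AE x in M. \<forall>k. \<bar>A k x\<bar> \<le> B" using bd by (simp add: AE_all_countable)
  have bda: "AE x in M. \<bar>a x\<bar> \<le> B"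
    using bdA lim
  proof eventually_elim
    case (elim x)
    then show ?case by (intro LIMSEQ_le_const2[OF tendsto_rabs[OF elim(2)]]) auto
  qed
  have 1: "L2_tendsto M (\<lambda>k x. A k x *\<^sub>R (F k x - f x)) (\<lambda>_. 0)"
    unfolding L2_tendsto_def
  proof (intro conjI allI)
    fix k show *: "square_integrable M (\<lambda>x. A k x *\<^sub>R (F k x - f x))" 
      using si by (intro square_integrable_bounded_scaleR[OF A bd]) auto
  next
    have "norm (ip M (\<lambda>x. A k x *\<^sub>R (F k x - f x) - 0) (\<lambda>x. A k x *\<^sub>R (F k x - f x) - 0))
        \<le> B\<^sup>2 * ip M (\<lambda>x. F k x - f x) (\<lambda>x. F k x - f x)" for k
    proof -
      have s: "square_integrable M (\<lambda>x. F k x - f x)" using si by auto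
      have s': "square_integrable M (\<lambda>x. A k x *\<^sub>R (F k x - f x))"
        by (rule square_integrable_bounded_scaleR[OF A bd s])
      have "ip M (\<lambda>x. A k x *\<^sub>R (F k x - f x)) (\<lambda>x. A k x *\<^sub>R (F k x - f x))
          \<le> B\<^sup>2 * ip M (\<lambda>x. F k x - f x) (\<lambda>x. F k x - f x)"
        unfolding ip_def Bochner_Integration.integral_mult_right_zero[symmetric]
      proof (rule integral_mono_AE)
        show "AE x in M. (A k x *\<^sub>R (F k x - f x)) \<bullet> (A k x *\<^sub>R (F k x - f x))
            \<le> B\<^sup>2 * ((F k x - f x) \<bullet> (F k x - f x))"
          using bd[of k]
        proof eventually_elim
          case (elim x)
          then have "\<bar>A k x\<bar>\<^sup>2 \<le> B\<^sup>2" by (intro power_mono) auto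
          then have "(A k x)\<^sup>2 * ((F k x - f x) \<bullet> (F k x - f x)) \<le> B\<^sup>2 * ((F k x - f x) \<bullet> (F k x - f x))"
            by (intro mult_right_mono) auto
          then show ?case by (simp add: power2_eq_square mult.assoc)
        qed
      qed (use integrable_inner_L2[OF s s] integrable_inner_L2[OF s' s'] in auto)
      then show ?thesis by simp
    qed
    then show "(\<lambda>k. ip M (\<lambda>x. A k x *\<^sub>R (F k x - f x) - 0) (\<lambda>x. A k x *\<^sub>R (F k x - f x) - 0)) \<longlonglongrightarrow> 0"
    proof (rule Lim_null_comparison[OF always_eventually[OF allI]])
      show "(\<lambda>k. B\<^sup>2 * ip M (\<lambda>x. F k x - f x) (\<lambda>x. F k x - f x)) \<longlonglongrightarrow> 0"
      using si by (auto intro!: tendsto_mult_right_zero)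
    qed
  next
    show "square_integrable M (\<lambda>_. 0)" by (rule square_integrable_zero)
  qed
  have 2: "L2_tendsto M (\<lambda>k x. A k x *\<^sub>R f x) (\<lambda>x. a x *\<^sub>R f x)"
    unfolding L2_tendsto_def
  proof (intro conjI allI)
    fix k show "square_integrable M (\<lambda>x. A k x *\<^sub>R f x)"
      using si by (intro square_integrable_bounded_scaleR[OF A bd]) auto
  next
    show "square_integrable M (\<lambda>x. a x *\<^sub>R f x)" 
      using si by (intro square_integrable_bounded_scaleR[OF a bda]) auto
  next
    note [measurable] = A a
    have [measurable]: "f \<in> borel_measurable M" using si square_integrable_measurable by blast
    have "(\<lambda>k. \<integral>x. (A k x *\<^sub>R f x - a x *\<^sub>R f x) \<bullet> (A k x *\<^sub>R f x - a x *\<^sub>R f x) \<partial>M) \<longlonglongrightarrow> (\<integral>x. 0 \<partial>M)"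
    proof (rule integral_dominated_convergence[where w="\<lambda>x. (2 * B)\<^sup>2 * (norm (f x))\<^sup>2"])
      show "integrable M (\<lambda>x. (2 * B)\<^sup>2 * (norm (f x))\<^sup>2)"
        using si by (auto simp: square_integrable_def)
      show "AE x in M. (\<lambda>k. (A k x *\<^sub>R f x - a x *\<^sub>R f x) \<bullet> (A k x *\<^sub>R f x - a x *\<^sub>R f x)) \<longlonglongrightarrow> 0"
        using lim
      proof eventually_elim
        case (elim x)
        have "(\<lambda>k. (A k x *\<^sub>R f x - a x *\<^sub>R f x) \<bullet> (A k x *\<^sub>R f x - a x *\<^sub>R f x)) \<longlonglongrightarrow>
          (a x *\<^sub>R f x - a x *\<^sub>R f x) \<bullet> (a x *\<^sub>R f x - a x *\<^sub>R f x)"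
          by (intro tendsto_intros elim)
        then show ?case by simp
      qed
      fix k
      show "AE x in M. norm ((A k x *\<^sub>R f x - a x *\<^sub>R f x) \<bullet> (A k x *\<^sub>R f x - a x *\<^sub>R f x))
          \<le> (2 * B)\<^sup>2 * (norm (f x))\<^sup>2"
        using bd[of k] bda
      proof eventually_elim
        case (elim x)
        then have "\<bar>A k x - a x\<bar>\<^sup>2 \<le> (2 * B)\<^sup>2" by (intro power_mono) auto
        then have "\<bar>A k x - a x\<bar>\<^sup>2 * (norm (f x))\<^sup>2 \<le> (2 * B)\<^sup>2 * (norm (f x))\<^sup>2"
          by (intro mult_right_mono) auto
        moreover have "(A k x *\<^sub>R f x - a x *\<^sub>R f x) \<bullet> (A k x *\<^sub>R f x - a x *\<^sub>R f x)
            = \<bar>A k x - a x\<bar>\<^sup>2 * (norm (f x))\<^sup>2"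
          by (simp add: scaleR_diff_left[symmetric] dot_square_norm power2_eq_square
              mult.assoc del: scaleR_diff_left)
        ultimately show ?case by simp
      qed
    qed simp_all
    then show "(\<lambda>k. ip M (\<lambda>x. A k x *\<^sub>R f x - a x *\<^sub>R f x) (\<lambda>x. A k x *\<^sub>R f x - a x *\<^sub>R f x)) \<longlonglongrightarrow> 0"
      by (simp add: ip_def)
  qed
  from L2_tendsto_add[OF 1 2] show ?thesis by (simp add: algebra_simps)
qed

section \<open>Completeness and separation\<close>

lemma nn_integral_ip_self:
  assumes "square_integrable M f"
  shows "(\<integral>\<^sup>+x. ennreal ((norm (f x))\<^sup>2) \<partial>M) = ennreal (ip M f f)"
  using assms by (simp add: square_integrable_def nn_integral_eq_integral ip_def dot_square_norm)

text \<open>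
  The Riesz-Fischer argument. Along a subsequence the increments \<open>d\<^sub>k\<close> satisfy
  \<open>\<parallel>d\<^sub>k\<parallel>\<^sup>2 \<le> 4\<^sup>-\<^sup>k\<close>, so \<open>\<Sum>\<^sub>k 2\<^sup>k |d\<^sub>k|\<^sup>2\<close> has finite integral and is finite almost everywhere; this forces
  pointwise convergence, and Fatou's lemma turns it into convergence in mean square.
\<close>

lemma L2_Cauchy_subsequence:
  fixes F :: "nat \<Rightarrow> 'b \<Rightarrow> 'a::euclidean_space"
  assumes F [simp]: "\<And>k. square_integrable M (F k)"
    and Cauchy: "\<And>e. e > 0 \<Longrightarrow>
      \<exists>N. \<forall>m\<ge>N. \<forall>n\<ge>N. ip M (\<lambda>x. F m x - F n x) (\<lambda>x. F m x - F n x) < e"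
  obtains r f where "strict_mono r" "L2_tendsto M (\<lambda>k. F (r k)) f"
    "AE x in M. (\<lambda>k. F (r k) x) \<longlonglongrightarrow> f x"
proof -
  define D where "D m n = ip M (\<lambda>x. F m x - F n x) (\<lambda>x. F m x - F n x)" for m n
  have [measurable]: "F k \<in> borel_measurable M" for k
    using F square_integrable_measurable by blast
  have "\<exists>r. \<forall>k. (\<forall>m\<ge>r k. \<forall>n\<ge>r k. D m n < (1/4)^k) \<and> r k < r (Suc k)"
  proof (rule dependent_nat_choice)
    show "\<exists>N. \<forall>m\<ge>N. \<forall>n\<ge>N. D m n < (1/4)^0"
      using Cauchy[of 1] by (auto simp: D_def)
    fix N k
    obtain N' where "\<forall>m\<ge>N'. \<forall>n\<ge>N'. D m n < (1/4)^Suc k"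
      using Cauchy[of "(1/4)^Suc k"] by (auto simp: D_def)
    then show "\<exists>N'. (\<forall>m\<ge>N'. \<forall>n\<ge>N'. D m n < (1/4)^Suc k) \<and> N < N'"
      by (intro exI[of _ "max N' (Suc N)"]) auto
  qed
  then obtain r where r: "\<And>k m n. m \<ge> r k \<Longrightarrow> n \<ge> r k \<Longrightarrow> D m n < (1/4)^k" "\<And>k. r k < r (Suc k)"
    by blast
  have mono: "strict_mono r" using r(2) by (simp add: strict_mono_Suc_iff)
  then have rle: "r k \<le> r l" if "k \<le> l" for k l
    using that by (simp add: strict_mono_less_eq)
  define d where "d k x = F (r (Suc k)) x - F (r k) x" for k x
  have [measurable]: "d k \<in> borel_measurable M" for k unfolding d_def by measurable
  have d: "square_integrable M (d k)" for k unfolding d_def by simp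
  have "(\<integral>\<^sup>+x. (\<Sum>k. ennreal (2^k * (norm (d k x))\<^sup>2)) \<partial>M)
      = (\<Sum>k. \<integral>\<^sup>+x. ennreal (2^k * (norm (d k x))\<^sup>2) \<partial>M)"
    by (rule nn_integral_suminf) measurable
  also have "\<dots> \<le> (\<Sum>k. ennreal ((1/2)^k))"
  proof (intro suminf_le allI)
    fix k
    have "(\<integral>\<^sup>+x. ennreal (2^k * (norm (d k x))\<^sup>2) \<partial>M) = ennreal (2^k) * ennreal (ip M (d k) (d k))"
      using nn_integral_ip_self[OF d[of k]] by (simp add: ennreal_mult' nn_integral_cmult)
    also have "\<dots> = ennreal (2^k * D (r (Suc k)) (r k))"
      by (simp add: ennreal_mult' D_def d_def[abs_def])
    also have "\<dots> \<le> ennreal (2^k * (1/4)^k)"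
      using r(1)[of k "r (Suc k)" "r k"] rle[of k "Suc k"] by (intro ennreal_leI mult_left_mono) auto
    also have "2^k * (1/4)^k = (1/2 :: real)^k" by (simp add: power_mult_distrib[symmetric])
    finally show "(\<integral>\<^sup>+x. ennreal (2^k * (norm (d k x))\<^sup>2) \<partial>M) \<le> ennreal ((1/2)^k)" .
  qed auto
  also have "\<dots> < \<infinity>"
    by (subst suminf_ennreal2) (auto simp: summable_geometric)
  finally have "AE x in M. (\<Sum>k. ennreal (2^k * (norm (d k x))\<^sup>2)) \<noteq> \<infinity>"
    by (intro nn_integral_PInf_AE) auto
  then have conv: "AE x in M. convergent (\<lambda>k. F (r k) x)"
  proof eventually_elim
    case (elim x)
    have "summable (\<lambda>k. 2^k * (norm (d k x))\<^sup>2)"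
      by (rule summable_suminf_not_top) (use elim in auto)
    then have "summable (\<lambda>k. (1/2)^k + 2^k * (norm (d k x))\<^sup>2)"
      by (intro summable_add) (auto simp: summable_geometric)
    then have "summable (\<lambda>k. d k x)"
    proof (rule summable_comparison_test'[where N=0])
      fix k :: nat
      \<comment> \<open>The arithmetic-geometric mean inequality for \<open>2\<^sup>-\<^sup>k\<close> and \<open>2\<^sup>k |d|\<^sup>2\<close>.\<close>
      define a where "a = sqrt (2^k)"
      have a: "a > 0" "a\<^sup>2 = 2^k" by (auto simp: a_def)
      have "norm (d k x) \<le> 2 * (1/a) * (a * norm (d k x))" using a by simp
      also have "\<dots> \<le> (1/a)\<^sup>2 + (a * norm (d k x))\<^sup>2"
        by (rule sum_squares_bound)
      finally show "norm (d k x) \<le> (1/2)^k + 2^k * (norm (d k x))\<^sup>2"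
        using a by (simp add: power_mult_distrib power_divide)
    qed
    then have "convergent (\<lambda>n. (\<Sum>k<n. d k x) + F (r 0) x)"
      unfolding summable_iff_convergent by (intro convergent_add convergent_const)
    then show ?case
      unfolding d_def sum_lessThan_telescope[of "\<lambda>k. F (r k) x"] by simp
  qed
  define f where "f x = lim (\<lambda>k. F (r k) x)" for x
  have [measurable]: "f \<in> borel_measurable M" unfolding f_def by measurable
  have lim: "AE x in M. (\<lambda>k. F (r k) x) \<longlonglongrightarrow> f x"
    using conv by eventually_elim (simp add: f_def convergent_LIMSEQ_iff)
  have Fatou: "(\<integral>\<^sup>+x. ennreal ((norm (F (r k) x - f x))\<^sup>2) \<partial>M) \<le> ennreal ((1/4)^k)" for k
  proof -
    have "(\<integral>\<^sup>+x. ennreal ((norm (F (r k) x - f x))\<^sup>2) \<partial>M)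
        = (\<integral>\<^sup>+x. liminf (\<lambda>l. ennreal ((norm (F (r k) x - F (r l) x))\<^sup>2)) \<partial>M)"
    proof (rule nn_integral_cong_AE)
      show "AE x in M. ennreal ((norm (F (r k) x - f x))\<^sup>2)
          = liminf (\<lambda>l. ennreal ((norm (F (r k) x - F (r l) x))\<^sup>2))"
        using lim
      proof eventually_elim
        case (elim x)
        have "(\<lambda>l. ennreal ((norm (F (r k) x - F (r l) x))\<^sup>2)) \<longlonglongrightarrow> ennreal ((norm (F (r k) x - f x))\<^sup>2)"
          by (intro tendsto_ennrealI tendsto_intros elim)
        then show ?case by (intro lim_imp_Liminf[symmetric]) auto
      qed
    qed
    also have "\<dots> \<le> liminf (\<lambda>l. \<integral>\<^sup>+x. ennreal ((norm (F (r k) x - F (r l) x))\<^sup>2) \<partial>M)"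
      by (rule nn_integral_liminf) measurable
    also have "\<dots> = liminf (\<lambda>l. ennreal (D (r k) (r l)))"
      by (simp add: nn_integral_ip_self D_def)
    also have "\<dots> \<le> ennreal ((1/4)^k)"
    proof (rule Liminf_le)
      show "\<forall>\<^sub>F l in sequentially. ennreal (D (r k) (r l)) \<le> ennreal ((1/4)^k)"
        using eventually_ge_at_top[of k]
      proof eventually_elim
        case (elim l)
        then show ?case using r(1)[of k "r k" "r l"] rle[of k l] by (intro ennreal_leI) auto
      qed
    qed simp
    finally show ?thesis .
  qed
  have diff: "square_integrable M (\<lambda>x. F (r k) x - f x)" for k
    unfolding square_integrable_def
    by (intro conjI integrableI_bounded)
      (use le_less_trans[OF Fatou[of k]] in \<open>auto simp: ennreal_less_top\<close>)
  have "square_integrable M (\<lambda>x. F (r 0) x - (F (r 0) x - f x))"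
    by (rule square_integrable_diff[OF F diff])
  then have f: "square_integrable M f" by simp
  have bound: "norm (ip M (\<lambda>x. F (r k) x - f x) (\<lambda>x. F (r k) x - f x)) \<le> (1/4)^k" for k
    using Fatou[of k] by (simp add: nn_integral_ip_self[OF diff])
  have "(\<lambda>k. ip M (\<lambda>x. F (r k) x - f x) (\<lambda>x. F (r k) x - f x)) \<longlonglongrightarrow> 0"
    by (rule Lim_null_comparison[OF always_eventually[OF allI, OF bound]])
      (simp add: LIMSEQ_power_zero)
  then have "L2_tendsto M (\<lambda>k. F (r k)) f" by (simp add: L2_tendsto_def f)
  then show ?thesis using that mono lim by blast
qed

lemma ip_self_eq_0_AE:
  assumes "square_integrable M f" "ip M f f \<le> 0"
  shows "AE x in M. f x = 0"
proof -
  have "(\<integral>x. f x \<bullet> f x \<partial>M) = 0"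
    using assms(2) ip_self_nonneg[of M f] unfolding ip_def by linarith
  then have "AE x in M. f x \<bullet> f x = 0"
    using integral_nonneg_eq_0_iff_AE[OF integrable_inner_L2[OF assms(1) assms(1)]] by simp
  then show ?thesis by simp
qed

lemma parallelogram_L2:
  assumes "square_integrable M f" "square_integrable M g"
  shows "ip M (\<lambda>x. f x - g x) (\<lambda>x. f x - g x)
    = 2 * ip M f f + 2 * ip M g g
      - 4 * ip M (\<lambda>x. (1/2) *\<^sub>R f x + (1/2) *\<^sub>R g x) (\<lambda>x. (1/2) *\<^sub>R f x + (1/2) *\<^sub>R g x)"
  using assms by (simp add: ip_algebra ip_commute[of M g f] field_simps)

text \<open>
  Hahn-Banach separation in Hilbert space: a point that no linear functional separates from a convex
  set is a limit of points of the set. If \<open>q\<close> is the projection of \<open>p\<close> onto the closure, then the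
  functional \<open>p - q\<close> is bounded on the set by its value at \<open>q\<close>, hence \<open>\<langle>p - q, p - q\<rangle> \<le> 0\<close>.
\<close>

lemma L2_closure_of_convex_set:
  fixes C :: "('b \<Rightarrow> 'a::euclidean_space) set"
  assumes C: "\<And>g. g \<in> C \<Longrightarrow> square_integrable M g" and ne: "C \<noteq> {}"
    and convex: "\<And>g h t. g \<in> C \<Longrightarrow> h \<in> C \<Longrightarrow> 0 \<le> t \<Longrightarrow> t \<le> 1 \<Longrightarrow>
      (\<lambda>x. g x + t *\<^sub>R (h x - g x)) \<in> C"
    and p [simp]: "square_integrable M p"
    and support: "\<And>z c. square_integrable M z \<Longrightarrow> (\<And>g. g \<in> C \<Longrightarrow> ip M g z \<le> c) \<Longrightarrow> ip M p z \<le> c"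
  obtains g where "\<And>k. g k \<in> C" "L2_tendsto M g p"
proof -
  define N where "N g = ip M (\<lambda>x. p x - g x) (\<lambda>x. p x - g x)" for g
  define d where "d = Inf (N ` C)"
  have bdd: "bdd_below (N ` C)" by (rule bdd_belowI[of _ 0]) (auto simp: N_def)
  have d: "d \<le> N g" if "g \<in> C" for g
    unfolding d_def using that bdd by (intro cInf_lower) auto
  have "\<exists>g. g \<in> C \<and> N g < d + inverse (real (Suc k))" for k
  proof -
    have "Inf (N ` C) < d + inverse (real (Suc k))" by (simp add: d_def)
    from cInf_lessD[OF _ this] ne show ?thesis by auto
  qed
  then obtain g where gC: "\<And>k. g k \<in> C" and gN: "\<And>k. N (g k) < d + inverse (real (Suc k))"
    by metis
  have [simp]: "square_integrable M (g k)" for k using C gC by blast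
  \<comment> \<open>A minimising sequence is Cauchy, since the midpoint of two of its terms lies in the set.\<close>
  have near: "ip M (\<lambda>x. g m x - g n x) (\<lambda>x. g m x - g n x)
      \<le> 2 * inverse (real (Suc m)) + 2 * inverse (real (Suc n))" for m n
  proof -
    have "(\<lambda>x. (1/2) *\<^sub>R (p x - g n x) + (1/2) *\<^sub>R (p x - g m x))
        = (\<lambda>x. p x - (g n x + (1/2) *\<^sub>R (g m x - g n x)))" 
      by (rule ext) (simp add: algebra_simps flip: scaleR_left_distrib)
    then have "ip M (\<lambda>x. (p x - g n x) - (p x - g m x)) (\<lambda>x. (p x - g n x) - (p x - g m x))
        = 2 * N (g n) + 2 * N (g m) - 4 * N (\<lambda>x. g n x + (1/2) *\<^sub>R (g m x - g n x))"
      by (subst parallelogram_L2) (simp_all add: N_def)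
    moreover have "d \<le> N (\<lambda>x. g n x + (1/2) *\<^sub>R (g m x - g n x))"
      by (intro d convex gC) auto
    ultimately show ?thesis using gN[of m] gN[of n] by simp
  qed
  obtain r q where r: "strict_mono r" and q: "L2_tendsto M (\<lambda>k. g (r k)) q"
  proof (rule L2_Cauchy_subsequence)
    fix e :: real assume "e > 0"
    then obtain K where K: "inverse (real (Suc K)) < e / 4" using reals_Archimedean[of "e/4"] by auto
    have small: "inverse (real (Suc m)) < e / 4" if "m \<ge> K" for m
      using that by (intro le_less_trans[OF _ K]) (simp add: field_simps)
    show "\<exists>N. \<forall>m\<ge>N. \<forall>n\<ge>N. ip M (\<lambda>x. g m x - g n x) (\<lambda>x. g m x - g n x) < e"
    proof (intro exI[of _ K] allI impI)
      fix m n assume "K \<le> m" "K \<le> n"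
      then show "ip M (\<lambda>x. g m x - g n x) (\<lambda>x. g m x - g n x) < e"
        using near[of m n] small[of m] small[of n] by linarith
    qed
  qed auto
  have [simp]: "square_integrable M q" using q by (simp add: L2_tendsto_def)
  have L2_diff: "L2_tendsto M (\<lambda>k x. h k x + (-1) *\<^sub>R H k x) (\<lambda>x. a x + (-1) *\<^sub>R b x)"
    if "L2_tendsto M h a" "L2_tendsto M H b" for h H a and b :: "'b \<Rightarrow> 'a"
    by (rule L2_tendsto_add[OF that(1) L2_tendsto_scaleR[OF that(2)]])
  have pq: "L2_tendsto M (\<lambda>k x. p x - g (r k) x) (\<lambda>x. p x - q x)"
    using L2_diff[OF L2_tendsto_const[OF p] q] by simp
  have Nlim: "(\<lambda>k. N (g (r k))) \<longlonglongrightarrow> d"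
  proof (rule LIMSEQ_subseq_LIMSEQ[unfolded comp_def, OF _ r])
    show "(\<lambda>k. N (g k)) \<longlonglongrightarrow> d"
    proof (rule tendsto_sandwich[where f="\<lambda>_. d" and h="\<lambda>k. d + inverse (real (Suc k))"])
      show "(\<lambda>k. d + inverse (real (Suc k))) \<longlonglongrightarrow> d"
        using tendsto_add[OF tendsto_const LIMSEQ_inverse_real_of_nat, of d] by simp
    qed (use d gC less_imp_le[OF gN] in \<open>auto intro!: always_eventually simp del: of_nat_Suc\<close>)
  qed
  \<comment> \<open>The variational inequality of the projection, obtained by moving from \<open>g (r k)\<close> towards \<open>h\<close>.\<close>
  have proj: "ip M (\<lambda>x. p x - q x) (\<lambda>x. h x - q x) \<le> 0" if h: "h \<in> C" for h
  proof -
    have [simp]: "square_integrable M h" using C h by blast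
    have hq: "L2_tendsto M (\<lambda>k x. h x - g (r k) x) (\<lambda>x. h x - q x)"
      using L2_diff[OF L2_tendsto_const[of M h] q] by simp
    let ?b = "ip M (\<lambda>x. p x - q x) (\<lambda>x. h x - q x)" and ?c = "ip M (\<lambda>x. h x - q x) (\<lambda>x. h x - q x)"
    have le: "0 \<le> t * ?c - 2 * ?b" if t: "0 < t" "t \<le> 1" for t
    proof -
      have "d \<le> N (g (r k)) + 2 * (-t) * ip M (\<lambda>x. p x - g (r k) x) (\<lambda>x. h x - g (r k) x)
          + (-t)\<^sup>2 * ip M (\<lambda>x. h x - g (r k) x) (\<lambda>x. h x - g (r k) x)" for k
      proof -
        have "d \<le> N (\<lambda>x. g (r k) x + t *\<^sub>R (h x - g (r k) x))"
          using t by (intro d convex gC h) auto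
        also have "\<dots> = ip M (\<lambda>x. (p x - g (r k) x) + (-t) *\<^sub>R (h x - g (r k) x))
            (\<lambda>x. (p x - g (r k) x) + (-t) *\<^sub>R (h x - g (r k) x))"
          by (simp add: N_def algebra_simps)
        also have "\<dots> = N (g (r k)) + 2 * (-t) * ip M (\<lambda>x. p x - g (r k) x) (\<lambda>x. h x - g (r k) x)
            + (-t)\<^sup>2 * ip M (\<lambda>x. h x - g (r k) x) (\<lambda>x. h x - g (r k) x)"
          unfolding N_def by (rule ip_add_scaleR_self) auto
        finally show ?thesis .
      qed
      moreover have "(\<lambda>k. N (g (r k)) + 2 * (-t) * ip M (\<lambda>x. p x - g (r k) x) (\<lambda>x. h x - g (r k) x)
          + (-t)\<^sup>2 * ip M (\<lambda>x. h x - g (r k) x) (\<lambda>x. h x - g (r k) x))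
          \<longlonglongrightarrow> d + 2 * (-t) * ?b + (-t)\<^sup>2 * ?c"
        by (intro tendsto_intros Nlim L2_tendsto_ip pq hq)
      ultimately have "d \<le> d + 2 * (-t) * ?b + (-t)\<^sup>2 * ?c"
        by (intro LIMSEQ_le_const) auto
      then have "0 \<le> t * (t * ?c - 2 * ?b)" by (simp add: power2_eq_square algebra_simps)
      then show ?thesis using t by (simp add: zero_le_mult_iff)
    qed
    have "((\<lambda>t. t * ?c - 2 * ?b) \<longlongrightarrow> 0 * ?c - 2 * ?b) (at_right 0)"
      by (intro tendsto_intros)
    moreover have "\<forall>\<^sub>F t in at_right (0::real). 0 \<le> t * ?c - 2 * ?b"
      using le by (auto simp: eventually_at_right_field intro!: exI[of _ 1])
    ultimately have "0 \<le> 0 * ?c - 2 * ?b"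
      by (intro tendsto_lowerbound) auto
    then show ?thesis by simp
  qed
  have "ip M p (\<lambda>x. p x - q x) \<le> ip M q (\<lambda>x. p x - q x)"
  proof (rule support)
    fix h assume "h \<in> C"
    then show "ip M h (\<lambda>x. p x - q x) \<le> ip M q (\<lambda>x. p x - q x)"
      using proj[of h] C[of h] by (simp add: ip_algebra ip_commute)
  qed simp
  then have "ip M (\<lambda>x. p x - q x) (\<lambda>x. p x - q x) \<le> 0"
    by (simp add: ip_diff_left[of M p q "\<lambda>x. p x - q x"])
  then have "AE x in M. p x - q x = 0"
    by (intro ip_self_eq_0_AE) simp_all
  then have "AE x in M. p x = q x" by simp
  then have "ip M (\<lambda>x. g (r k) x - p x) (\<lambda>x. g (r k) x - p x)
      = ip M (\<lambda>x. g (r k) x - q x) (\<lambda>x. g (r k) x - q x)" for k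
    unfolding ip_def
  proof (intro integral_cong_AE borel_measurable_inner square_integrable_measurable)
    show "AE x in M. (g (r k) x - p x) \<bullet> (g (r k) x - p x) = (g (r k) x - q x) \<bullet> (g (r k) x - q x)"
      using \<open>AE x in M. p x = q x\<close> by eventually_elim simp
  qed simp_all
  then have "L2_tendsto M (\<lambda>k. g (r k)) p" using q by (simp add: L2_tendsto_def)
  then show ?thesis using that[of "\<lambda>k. g (r k)"] gC by blast
qed

section \<open>Smooth functions and gradients\<close>

lemma Ck_Suc_D: "Ck (Suc k) v \<Longrightarrow> Ck k v"
proof (induction k arbitrary: v)
  case 0
  then have "v differentiable (at x)" for x by simp
  then show ?case
    by (simp add: continuous_at_imp_continuous_on differentiable_imp_continuous_within)
next
  case (Suc k)
  then show ?case by simp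
qed

lemma has_derivative_partial_deriv:
  "v differentiable (at x) \<Longrightarrow> (v has_derivative (\<lambda>h. \<Sum>i\<in>Basis. (h \<bullet> i) * partial_deriv i v x)) (at x)"
proof -
  assume "v differentiable (at x)"
  then have D: "(v has_derivative frechet_derivative v (at x)) (at x)"
    by (simp add: frechet_derivative_works)
  then interpret linear "frechet_derivative v (at x)" by (rule has_derivative_linear)
  have "frechet_derivative v (at x) h = (\<Sum>i\<in>Basis. (h \<bullet> i) * partial_deriv i v x)" for h
  proof -
    have "frechet_derivative v (at x) h = frechet_derivative v (at x) (\<Sum>i\<in>Basis. (h \<bullet> i) *\<^sub>R i)"
      by (simp add: euclidean_representation)
    also have "\<dots> = (\<Sum>i\<in>Basis. (h \<bullet> i) * partial_deriv i v x)"
      by (simp add: sum scale partial_deriv_def)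
    finally show ?thesis .
  qed
  then have "frechet_derivative v (at x) = (\<lambda>h. \<Sum>i\<in>Basis. (h \<bullet> i) * partial_deriv i v x)"
    by (rule ext)
  then show ?thesis using D by simp
qed

lemma partial_deriv_eqI:
  "(v has_derivative v') (at x) \<Longrightarrow> partial_deriv i v x = v' i"
  by (simp add: partial_deriv_def frechet_derivative_at[symmetric])

lemma partial_deriv_add:
  assumes "v differentiable (at x)" "w differentiable (at x)"
  shows "partial_deriv i (\<lambda>x. v x + w x) x = partial_deriv i v x + partial_deriv i w x"
  unfolding partial_deriv_def
  by (rule partial_deriv_eqI[unfolded partial_deriv_def])
    (intro has_derivative_add assms[unfolded frechet_derivative_works])

lemma partial_deriv_mult:
  assumes "v differentiable (at x)" "w differentiable (at x)"
  shows "partial_deriv i (\<lambda>x. v x * w x) x = v x * partial_deriv i w x + partial_deriv i v x * w x"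
  unfolding partial_deriv_def
  by (rule partial_deriv_eqI[unfolded partial_deriv_def])
    (intro has_derivative_mult assms[unfolded frechet_derivative_works])

lemma Ck_const: "Ck k (\<lambda>x. c)"
proof (induction k arbitrary: c)
  case (Suc k)
  have "partial_deriv i (\<lambda>x::'a. c) = (\<lambda>x. 0)" for i
    by (simp add: partial_deriv_def fun_eq_iff)
  then show ?case using Suc by simp
qed simp

lemma Ck_add: "Ck k v \<Longrightarrow> Ck k w \<Longrightarrow> Ck k (\<lambda>x. v x + w x)"
proof (induction k arbitrary: v w)
  case (Suc k)
  have "partial_deriv i (\<lambda>x. v x + w x) = (\<lambda>x. partial_deriv i v x + partial_deriv i w x)" for i
    using Suc.prems by (intro ext partial_deriv_add) auto
  then show ?case using Suc by simp
qed (simp add: continuous_on_add)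

text \<open>
  The product rule expresses the partial derivatives of a product through factors that are \<open>k\<close> times
  continuously differentiable, so the induction closes.
\<close>

lemma Ck_mult: "Ck k v \<Longrightarrow> Ck k w \<Longrightarrow> Ck k (\<lambda>x. v x * w x)"
proof (induction k arbitrary: v w)
  case (Suc k)
  have "partial_deriv i (\<lambda>x. v x * w x)
      = (\<lambda>x. v x * partial_deriv i w x + partial_deriv i v x * w x)" for i
    using Suc.prems by (intro ext partial_deriv_mult) auto
  moreover have "Ck k (\<lambda>x. v x * partial_deriv i w x + partial_deriv i v x * w x)"
    if "i \<in> Basis" for i
    using Ck_add[OF Suc.IH[OF Ck_Suc_D[OF Suc.prems(1)]] Suc.IH[OF _ Ck_Suc_D[OF Suc.prems(2)]]]
      Suc.prems that by simp
  ultimately show ?case using Suc.prems by simp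
qed (simp add: continuous_on_mult)

lemma Ck_coordinate: "Ck k (\<lambda>x::'a::euclidean_space. x \<bullet> i)"
proof (cases k)
  case (Suc k)
  have "partial_deriv j (\<lambda>x::'a. x \<bullet> i) = (\<lambda>x. j \<bullet> i)" for j
    by (rule ext, rule partial_deriv_eqI, rule has_derivative_inner_left[OF has_derivative_ident])
  moreover have "(\<lambda>x::'a. x \<bullet> i) differentiable (at y)" for y
    by (rule differentiableI[OF has_derivative_inner_left[OF has_derivative_ident]])
  ultimately show ?thesis using Suc by (simp add: Ck_const)
qed (simp add: continuous_on_inner)

definition smooth :: "('a::euclidean_space \<Rightarrow> real) \<Rightarrow> bool" where
  "smooth v \<longleftrightarrow> (\<forall>k. Ck k v)"

lemma smooth_const: "smooth (\<lambda>x. c)" by (simp add: smooth_def Ck_const)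
lemma smooth_add: "smooth v \<Longrightarrow> smooth w \<Longrightarrow> smooth (\<lambda>x. v x + w x)"
  by (simp add: smooth_def Ck_add)
lemma smooth_mult: "smooth v \<Longrightarrow> smooth w \<Longrightarrow> smooth (\<lambda>x. v x * w x)"
  by (simp add: smooth_def Ck_mult)
lemma smooth_diff: "smooth v \<Longrightarrow> smooth w \<Longrightarrow> smooth (\<lambda>x. v x - w x)"
  using smooth_add[of v "\<lambda>x. (-1) * w x"] smooth_mult[OF smooth_const, of w "-1"] by simp
lemma smooth_power: "smooth v \<Longrightarrow> smooth (\<lambda>x. v x ^ n)"
  by (induction n) (simp_all add: smooth_const smooth_mult)
lemma smooth_coordinate: "smooth (\<lambda>x. x \<bullet> i)"
  by (simp add: smooth_def Ck_coordinate)

lemma smooth_differentiable: "smooth v \<Longrightarrow> v differentiable (at x)"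
  unfolding smooth_def using Ck.simps(2) by blast

lemma smooth_partial_deriv: "smooth v \<Longrightarrow> i \<in> Basis \<Longrightarrow> smooth (partial_deriv i v)"
  unfolding smooth_def using Ck.simps(2) by blast

lemma smooth_continuous: "smooth v \<Longrightarrow> continuous_on UNIV v"
  unfolding smooth_def using Ck.simps(1) by blast

lemma grad_inner: "grad v x \<bullet> h = (\<Sum>i\<in>Basis. (h \<bullet> i) * partial_deriv i v x)"
  unfolding grad_def inner_sum_left inner_scaleR_left
  by (rule sum.cong) (simp_all add: inner_commute)

lemma has_derivative_grad: "smooth v \<Longrightarrow> (v has_derivative (\<lambda>h. grad v x \<bullet> h)) (at x)"
  unfolding grad_inner by (intro has_derivative_partial_deriv smooth_differentiable)

lemma grad_eqI:
  assumes "(v has_derivative (\<lambda>h. g \<bullet> h)) (at x)"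
  shows "grad v x = g"
  unfolding grad_def partial_deriv_eqI[OF assms] by (rule euclidean_representation)

lemma grad_inner_eq_partial_deriv: "smooth v \<Longrightarrow> grad v x \<bullet> i = partial_deriv i v x"
  by (rule partial_deriv_eqI[symmetric, OF has_derivative_grad])

lemma continuous_on_grad: "smooth v \<Longrightarrow> continuous_on UNIV (grad v)"
  unfolding grad_def[abs_def]
  by (intro continuous_on_sum continuous_on_scaleR continuous_on_const smooth_continuous
      smooth_partial_deriv)

lemma grad_add:
  assumes "smooth v" "smooth w"
  shows "grad (\<lambda>x. v x + w x) x = grad v x + grad w x"
proof (rule grad_eqI)
  show "((\<lambda>x. v x + w x) has_derivative (\<lambda>h. (grad v x + grad w x) \<bullet> h)) (at x)"
    by (rule has_derivative_eq_rhs[OF has_derivative_add[OF has_derivative_grad[OF assms(1)] has_derivative_grad[OF assms(2)]]])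
      (simp add: inner_add_left)
qed

lemma grad_diff:
  assumes "smooth v" "smooth w"
  shows "grad (\<lambda>x. v x - w x) x = grad v x - grad w x"
proof (rule grad_eqI)
  show "((\<lambda>x. v x - w x) has_derivative (\<lambda>h. (grad v x - grad w x) \<bullet> h)) (at x)"
    by (rule has_derivative_eq_rhs[OF has_derivative_diff[OF has_derivative_grad[OF assms(1)] has_derivative_grad[OF assms(2)]]])
      (simp add: inner_diff_left)
qed

lemma grad_mult:
  assumes "smooth v" "smooth w"
  shows "grad (\<lambda>x. v x * w x) x = w x *\<^sub>R grad v x + v x *\<^sub>R grad w x"
proof (rule grad_eqI)
  show "((\<lambda>x. v x * w x) has_derivative (\<lambda>h. (w x *\<^sub>R grad v x + v x *\<^sub>R grad w x) \<bullet> h)) (at x)"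
    by (rule has_derivative_eq_rhs[OF has_derivative_mult[OF has_derivative_grad[OF assms(1)] has_derivative_grad[OF assms(2)]]])
      (simp add: inner_add_left algebra_simps)
qed

lemma grad_cmult:
  assumes "smooth v"
  shows "grad (\<lambda>x. c * v x) x = c *\<^sub>R grad v x"
proof (rule grad_eqI)
  show "((\<lambda>x. c * v x) has_derivative (\<lambda>h. (c *\<^sub>R grad v x) \<bullet> h)) (at x)"
    by (rule has_derivative_eq_rhs[OF has_derivative_mult_right[OF has_derivative_grad[OF assms]]])
      (simp)
qed

lemma grad_power:
  assumes "smooth v"
  shows "grad (\<lambda>x. v x ^ n) x = (real n * v x ^ (n - 1)) *\<^sub>R grad v x"
proof (rule grad_eqI)
  show "((\<lambda>x. v x ^ n) has_derivative (\<lambda>h. ((real n * v x ^ (n - 1)) *\<^sub>R grad v x) \<bullet> h)) (at x)"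
    by (rule has_derivative_eq_rhs[OF has_derivative_power[OF has_derivative_grad[OF assms]]])
      (simp add: mult_ac)
qed

section \<open>Integration by parts and the Poincare inequality\<close>

text \<open>
  The integral of a difference quotient vanishes by translation invariance of Lebesgue measure, and
  the difference quotients converge boundedly on a fixed ball.
\<close>

lemma integral_directional_derivative_eq_0:
  fixes F :: "'a::euclidean_space \<Rightarrow> real"
  assumes F: "smooth F" and K: "compact K" and F0: "\<And>x. x \<notin> K \<Longrightarrow> F x = 0"
  shows "(\<integral>x. grad F x \<bullet> e \<partial>lborel) = 0"
proof -
  obtain R where R: "\<And>x. x \<in> K \<Longrightarrow> norm x \<le> R"
    using compact_imp_bounded[OF K] by (auto simp: bounded_iff)
  \<comment> \<open>The difference quotients with step at most 1 live on \<open>S\<close>, and the mean value theorem evaluates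
    the gradient at most \<open>norm e\<close> further out.\<close>
  define S where "S = cball (0::'a) (R + norm e)"
  have "bounded ((\<lambda>x. grad F x \<bullet> e) ` cball 0 (R + norm e + norm e))"
    by (intro compact_imp_bounded compact_continuous_image continuous_intros
        continuous_on_subset[OF continuous_on_grad[OF F]]) auto
  then obtain B where B: "\<And>x. x \<in> cball (0::'a) (R + norm e + norm e) \<Longrightarrow> \<bar>grad F x \<bullet> e\<bar> \<le> B"
    unfolding bounded_iff by fastforce
  have cF: "continuous_on UNIV F" by (rule smooth_continuous[OF F])
  have [measurable]: "F \<in> borel_measurable borel"
    by (rule borel_measurable_continuous_onI[OF cF])
  define h :: "nat \<Rightarrow> real" where "h n = inverse (real (Suc n))" for n
  have h: "0 < h n" "h n \<le> 1" for n by (auto simp: h_def inverse_eq_divide)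
  have h0: "h \<longlonglongrightarrow> 0" using LIMSEQ_inverse_real_of_nat by (simp add: h_def[abs_def])
  define q where "q n x = (F (x + h n *\<^sub>R e) - F x) / h n" for n x
  have dF: "((\<lambda>t. F (x + t *\<^sub>R e)) has_real_derivative (grad F (x + t *\<^sub>R e) \<bullet> e)) (at t)" for x t
  proof -
    have "((\<lambda>t. x + t *\<^sub>R e) has_derivative (\<lambda>s. s *\<^sub>R e)) (at t)"
      by (auto intro!: derivative_eq_intros)
    from diff_chain_at[OF this has_derivative_grad[OF F]]
    show ?thesis by (simp add: has_field_derivative_def comp_def mult.commute[of _ "_ \<bullet> e"])
  qed
  have bound: "\<bar>q n x\<bar> \<le> B * indicator S x" for n x
  proof (cases "x \<in> S")
    case True
    obtain z where z: "0 < z" "z < h n"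
      "F (x + h n *\<^sub>R e) - F (x + 0 *\<^sub>R e) = (h n - 0) * (grad F (x + z *\<^sub>R e) \<bullet> e)"
      using MVT2[OF h(1)[of n], of "\<lambda>t. F (x + t *\<^sub>R e)" "\<lambda>t. grad F (x + t *\<^sub>R e) \<bullet> e", OF dF]
      by blast
    have "norm (x + z *\<^sub>R e) \<le> norm x + norm (z *\<^sub>R e)" by (rule norm_triangle_ineq)
    also have "\<dots> \<le> (R + norm e) + 1 * norm e"
      unfolding norm_scaleR
      using True z h(2)[of n] by (intro add_mono mult_right_mono) (auto simp: S_def)
    finally have "\<bar>grad F (x + z *\<^sub>R e) \<bullet> e\<bar> \<le> B" by (intro B) simp
    then show ?thesis using z(3) h(1)[of n] True by (simp add: q_def)
  next
    case False
    have far: "R + norm e < norm x" using False by (simp add: S_def)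
    have "x \<notin> K"
    proof
      assume "x \<in> K"
      from R[OF this] far norm_ge_zero[of e] show False by linarith
    qed
    moreover have "x + h n *\<^sub>R e \<notin> K"
    proof
      assume "x + h n *\<^sub>R e \<in> K"
      then have "norm (x + h n *\<^sub>R e) \<le> R" by (rule R)
      moreover have "norm x \<le> norm (x + h n *\<^sub>R e) + norm (h n *\<^sub>R e)"
        using norm_triangle_ineq4[of "x + h n *\<^sub>R e" "h n *\<^sub>R e"] by simp
      moreover have "norm (h n *\<^sub>R e) \<le> 1 * norm e"
        unfolding norm_scaleR using h[of n] by (intro mult_right_mono) auto
      ultimately show False using far by linarith
    qed
    ultimately show ?thesis using False by (simp add: q_def F0)
  qed
  have iS: "integrable lborel (\<lambda>x. B * indicator S x :: real)"
    by (intro integrable_mult_right integrable_real_indicator)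
      (use emeasure_bounded_finite[OF bounded_cball, of "0::'a" "R + norm e"] in \<open>auto simp: S_def\<close>)
  have iF: "integrable lborel F"
  proof -
    have "integrable lborel (\<lambda>x. indicator K x *\<^sub>R F x)"
      by (intro borel_integrable_compact K continuous_on_subset[OF cF]) auto
    also have "(\<lambda>x. indicator K x *\<^sub>R F x) = F" using F0 by (fastforce simp: indicator_def)
    finally show ?thesis .
  qed
  have translate: "has_bochner_integral lborel (\<lambda>x. F (x + c)) (\<integral>x. F x \<partial>lborel)" for c
  proof -
    have "integrable (distr lborel borel ((+) c)) F"
      "integral\<^sup>L (distr lborel borel ((+) c)) F = (\<integral>x. F x \<partial>lborel)"
      using iF by (simp_all add: lborel_distr_plus)
    then show ?thesis
      by (simp add: has_bochner_integral_iff integrable_distr_eq integral_distr add.commute[of c])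
  qed
  have "(\<integral>x. q n x \<partial>lborel) = 0" for n
    using translate[of "h n *\<^sub>R e"] iF
    by (simp add: q_def[abs_def] has_bochner_integral_iff)
  moreover have "(\<lambda>n. \<integral>x. q n x \<partial>lborel) \<longlonglongrightarrow> (\<integral>x. grad F x \<bullet> e \<partial>lborel)"
  proof (rule integral_dominated_convergence[OF _ _ iS])
    have "(\<lambda>x. grad F x \<bullet> e) \<in> borel_measurable borel"
      by (intro borel_measurable_continuous_onI continuous_intros continuous_on_grad F)
    then show "(\<lambda>x. grad F x \<bullet> e) \<in> borel_measurable lborel" by simp
    show "q n \<in> borel_measurable lborel" for n unfolding q_def by measurable
    show "AE x in lborel. (\<lambda>n. q n x) \<longlonglongrightarrow> grad F x \<bullet> e"
    proof (intro AE_I2)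
      fix x
      have "((\<lambda>t. (F (x + t *\<^sub>R e) - F x) / t) \<longlongrightarrow> grad F x \<bullet> e) (at 0)"
        using dF[of x 0] by (simp add: DERIV_def)
      then show "(\<lambda>n. q n x) \<longlonglongrightarrow> grad F x \<bullet> e"
        unfolding q_def
        by (rule filterlim_compose) 
          (use h h0 in \<open>auto simp: filterlim_at less_le intro!: always_eventually\<close>)
    qed
    show "AE x in lborel. norm (q n x) \<le> B * indicator S x" for n
      using bound by simp
  qed
  ultimately show ?thesis by (simp add: LIMSEQ_const_iff)
qed

text \<open>
  Asking for some compact set off which the function vanishes, instead of a compact support, makes
  the condition evidently stable under sums and products.
\<close>

definition supported_in :: "'a::euclidean_space set \<Rightarrow> ('a \<Rightarrow> real) \<Rightarrow> bool" where
  "supported_in \<Omega> v \<longleftrightarrow> (\<exists>K. compact K \<and> K \<subseteq> \<Omega> \<and> (\<forall>x. x \<notin> K \<longrightarrow> v x = 0))"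

lemma supported_in_mono:
  assumes "supported_in \<Omega> v" "\<And>x. v x = 0 \<Longrightarrow> w x = 0"
  shows "supported_in \<Omega> w"
  using assms unfolding supported_in_def by metis

lemma supported_in_Un:
  assumes "supported_in \<Omega> v" "supported_in \<Omega> w" "\<And>x. v x = 0 \<Longrightarrow> w x = 0 \<Longrightarrow> z x = 0"
  shows "supported_in \<Omega> z"
proof -
  obtain K L where "compact K" "K \<subseteq> \<Omega>" "\<And>x. x \<notin> K \<Longrightarrow> v x = 0"
    "compact L" "L \<subseteq> \<Omega>" "\<And>x. x \<notin> L \<Longrightarrow> w x = 0"
    using assms unfolding supported_in_def by metis
  then show ?thesis unfolding supported_in_def
    using assms(3) by (intro exI[of _ "K \<union> L"]) (simp add: compact_Un)
qed

lemma test_functions_iff: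
  "v \<in> test_functions \<Omega> \<longleftrightarrow> smooth v \<and> supported_in \<Omega> v \<and> (\<forall>x. \<bar>v x\<bar> \<le> 1)"
proof -
  have "supported_in \<Omega> v \<longleftrightarrow> compact (closure {x. v x \<noteq> 0}) \<and> closure {x. v x \<noteq> 0} \<subseteq> \<Omega>"
  proof
    assume "supported_in \<Omega> v"
    then obtain K where K: "compact K" "K \<subseteq> \<Omega>" "\<And>x. x \<notin> K \<Longrightarrow> v x = 0"
      by (auto simp: supported_in_def)
    then have "closure {x. v x \<noteq> 0} \<subseteq> K"
      by (intro closure_minimal compact_imp_closed) auto
    moreover have "bounded {x. v x \<noteq> 0}"
      using K by (intro bounded_subset[OF compact_imp_bounded[OF K(1)]]) auto
    ultimately show "compact (closure {x. v x \<noteq> 0}) \<and> closure {x. v x \<noteq> 0} \<subseteq> \<Omega>"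
      using K(2) by auto
  next
    assume "compact (closure {x. v x \<noteq> 0}) \<and> closure {x. v x \<noteq> 0} \<subseteq> \<Omega>"
    moreover have "v x = 0" if "x \<notin> closure {x. v x \<noteq> 0}" for x
      using that closure_subset[of "{x. v x \<noteq> 0}"] by blast
    ultimately show "supported_in \<Omega> v" unfolding supported_in_def by blast
  qed
  moreover have "range v \<subseteq> {-1..1} \<longleftrightarrow> (\<forall>x. \<bar>v x\<bar> \<le> 1)"
    by (auto simp: image_subset_iff abs_le_iff minus_le_iff)
  ultimately show ?thesis by (auto simp: test_functions_def smooth_def)
qed

lemma grad_eq_0_outside:
  assumes "closed K" "\<And>x. x \<notin> K \<Longrightarrow> v x = 0" "x \<notin> K"
  shows "grad v x = 0"
proof (rule grad_eqI)
  have "((\<lambda>_. 0) has_derivative (\<lambda>h. 0 \<bullet> h)) (at x)" by simp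
  then show "(v has_derivative (\<lambda>h. 0 \<bullet> h)) (at x)"
    by (rule has_derivative_transform_within_open[where s="- K"]) (use assms in auto)
qed

lemma borel_measurable_lebesgue_on_continuous:
  "continuous_on UNIV f \<Longrightarrow> f \<in> borel_measurable (lebesgue_on \<Omega>)"
  by (intro measurable_restrict_space1 measurable_completion)
    (simp add: borel_measurable_continuous_onI)

lemma finite_measure_lebesgue_on_bounded:
  "open \<Omega> \<Longrightarrow> bounded \<Omega> \<Longrightarrow> finite_measure (lebesgue_on \<Omega>)"
  by (intro finite_measure_lebesgue_on lmeasurable_open)

lemma integrable_lebesgue_on_continuous:
  fixes f :: "'a::euclidean_space \<Rightarrow> real"
  assumes \<Omega>: "open \<Omega>" "bounded \<Omega>" and f: "continuous_on UNIV f"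
  shows "integrable (lebesgue_on \<Omega>) f"
proof -
  interpret finite_measure "lebesgue_on \<Omega>"
    by (rule finite_measure_lebesgue_on_bounded[OF \<Omega>])
  have "bounded (f ` closure \<Omega>)"
    using \<Omega>(2) by (intro compact_imp_bounded compact_continuous_image continuous_on_subset[OF f]) auto
  then obtain B where "\<forall>x\<in>closure \<Omega>. \<bar>f x\<bar> \<le> B" unfolding bounded_iff by auto
  then have "AE x in lebesgue_on \<Omega>. norm (f x) \<le> B"
    using closure_subset[of \<Omega>] by (intro AE_I2) auto
  then show ?thesis
    by (rule integrable_const_bound) (rule borel_measurable_lebesgue_on_continuous[OF f])
qed

lemma square_integrable_continuous:
  assumes "open \<Omega>" "bounded \<Omega>" and "continuous_on UNIV f"
  shows "square_integrable (lebesgue_on \<Omega>) f"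
  unfolding square_integrable_def using assms
  by (intro conjI borel_measurable_lebesgue_on_continuous integrable_lebesgue_on_continuous
      continuous_intros)

lemma integral_derivative_supported:
  assumes \<Omega>: "open \<Omega>" and F: "smooth F" "supported_in \<Omega> F"
  shows "(\<integral>x. grad F x \<bullet> e \<partial>lebesgue_on \<Omega>) = 0"
proof -
  obtain K where K: "compact K" "K \<subseteq> \<Omega>" "\<And>x. x \<notin> K \<Longrightarrow> F x = 0"
    using F(2) by (auto simp: supported_in_def)
  have "(\<lambda>x. grad F x \<bullet> e) \<in> borel_measurable lborel"
    using borel_measurable_continuous_onI[OF continuous_on_inner[OF continuous_on_grad[OF F(1)] continuous_on_const]]
    by simp
  then have "(\<integral>x. grad F x \<bullet> e \<partial>lborel) = (\<integral>x. grad F x \<bullet> e \<partial>lebesgue)"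
    by (rule integral_completion[symmetric])
  moreover have "(\<integral>x. grad F x \<bullet> e \<partial>lebesgue_on \<Omega>)
      = (\<integral>x. indicator \<Omega> x *\<^sub>R (grad F x \<bullet> e) \<partial>lebesgue)"
    using \<Omega> by (intro integral_restrict_space) auto
  moreover have "indicator \<Omega> x *\<^sub>R (grad F x \<bullet> e) = grad F x \<bullet> e" for x
    using grad_eq_0_outside[of K F x] compact_imp_closed[OF K(1)] K(2,3)
    by (cases "x \<in> K") (auto simp: indicator_def)
  moreover have "(\<integral>x. grad F x \<bullet> e \<partial>lborel) = 0"
    by (rule integral_directional_derivative_eq_0[OF F(1) K(1)]) (rule K(3))
  ultimately show ?thesis by (simp only:)
qed

text \<open>
  Integrate \<open>\<partial>\<^sub>i(x\<^sub>i v\<^sup>2) = v\<^sup>2 + 2 x\<^sub>i v \<partial>\<^sub>i v\<close> for a single coordinate \<open>i\<close>: the left side contributes nothing,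
  and half of \<open>v\<^sup>2\<close> absorbs the mixed term.
\<close>

lemma Poincare_inequality:
  fixes v :: "'a::euclidean_space \<Rightarrow> real"
  assumes \<Omega>: "open \<Omega>" "\<And>x. x \<in> \<Omega> \<Longrightarrow> norm x \<le> R" and v: "smooth v" "supported_in \<Omega> v"
  shows "ip (lebesgue_on \<Omega>) v v \<le> 4 * R\<^sup>2 * ip (lebesgue_on \<Omega>) (grad v) (grad v)"
proof -
  have bdd: "bounded \<Omega>" using \<Omega>(2) by (auto simp: bounded_iff)
  note cont = smooth_continuous[OF v(1)] continuous_on_grad[OF v(1)]
  note int = integrable_lebesgue_on_continuous[OF \<Omega>(1) bdd]
  obtain e :: 'a where e: "e \<in> Basis" by (meson nonempty_Basis ex_in_conv)
  let ?F = "\<lambda>x. (x \<bullet> e) * (v x)\<^sup>2"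
  have F: "smooth ?F" by (intro smooth_mult smooth_coordinate smooth_power v)
  have gF: "grad ?F x \<bullet> e = (v x)\<^sup>2 + 2 * (x \<bullet> e) * v x * (grad v x \<bullet> e)" for x
  proof -
    have "grad (\<lambda>x. x \<bullet> e) x = e"
      by (rule grad_eqI)
        (rule has_derivative_eq_rhs[OF has_derivative_inner_left[OF has_derivative_ident]],
          simp add: inner_commute)
    then show ?thesis
      using e by (simp add: grad_mult grad_power smooth_coordinate smooth_power v inner_add_left)
  qed
  have iF: "integrable (lebesgue_on \<Omega>) (\<lambda>x. grad ?F x \<bullet> e)"
    by (intro int continuous_intros continuous_on_grad F)
  have iv: "integrable (lebesgue_on \<Omega>) (\<lambda>x. (v x)\<^sup>2)"
    by (intro int continuous_intros cont)
  have ig: "integrable (lebesgue_on \<Omega>) (\<lambda>x. grad v x \<bullet> grad v x)"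
    by (intro int continuous_intros cont)
  have "(\<integral>x. grad ?F x \<bullet> e \<partial>lebesgue_on \<Omega>) = 0"
    by (rule integral_derivative_supported[OF \<Omega>(1) F supported_in_mono[OF v(2)]]) simp
  then have "(\<integral>x. (v x)\<^sup>2 \<partial>lebesgue_on \<Omega>) = (\<integral>x. (v x)\<^sup>2 - grad ?F x \<bullet> e \<partial>lebesgue_on \<Omega>)"
    using iF iv by simp
  also have "\<dots> \<le> (\<integral>x. (v x)\<^sup>2 / 2 + 2 * R\<^sup>2 * (grad v x \<bullet> grad v x) \<partial>lebesgue_on \<Omega>)"
  proof (rule integral_mono)
    fix x assume "x \<in> space (lebesgue_on \<Omega>)"
    then have x: "norm x \<le> R" using \<Omega>(2) by simp
    let ?d = "grad v x \<bullet> e"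
    have "\<bar>?d\<bar> \<le> norm (grad v x)" using e by (rule Basis_le_norm)
    moreover have "\<bar>x \<bullet> e\<bar> \<le> R" using Basis_le_norm[OF e, of x] x by linarith
    ultimately have "\<bar>x \<bullet> e\<bar> * \<bar>?d\<bar> \<le> R * norm (grad v x)"
      by (intro mult_mono) auto
    then have "(\<bar>x \<bullet> e\<bar> * \<bar>?d\<bar>)\<^sup>2 \<le> (R * norm (grad v x))\<^sup>2"
      by (intro power_mono) auto
    then have "((x \<bullet> e) * ?d)\<^sup>2 \<le> R\<^sup>2 * (grad v x \<bullet> grad v x)"
      by (simp add: power_mult_distrib power2_norm_eq_inner)
    moreover have "- (2 * (x \<bullet> e) * v x * ?d) \<le> (v x)\<^sup>2 / 2 + 2 * ((x \<bullet> e) * ?d)\<^sup>2"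
    proof -
      have "0 \<le> (v x + 2 * ((x \<bullet> e) * ?d))\<^sup>2 / 2" by simp
      then show ?thesis by (simp add: power2_eq_square field_simps)
    qed
    ultimately show "(v x)\<^sup>2 - grad ?F x \<bullet> e \<le> (v x)\<^sup>2 / 2 + 2 * R\<^sup>2 * (grad v x \<bullet> grad v x)"
      unfolding gF by simp
  qed (use iF iv ig in auto)
  also have "\<dots> = (\<integral>x. (v x)\<^sup>2 \<partial>lebesgue_on \<Omega>) / 2
      + 2 * R\<^sup>2 * (\<integral>x. grad v x \<bullet> grad v x \<partial>lebesgue_on \<Omega>)"
    using iv ig by simp
  finally show ?thesis by (simp add: ip_def power2_eq_square)
qed

text \<open>
  Integration by parts turns the integral into \<open>-1/(n+1) \<integral> v\<^sup>n\<^sup>+\<^sup>1 \<Delta>w\<close>. In the limit \<open>n \<rightarrow> \<infinity>\<close> the weight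
  \<open>v\<^sup>n\<close> concentrates on \<open>{|v| = 1}\<close>, so the decay in \<open>n\<close>, uniform in \<open>v\<close>, replaces the statement that the
  gradient of a Sobolev function vanishes almost everywhere on its level sets.
\<close>

lemma integral_power_grad_bound:
  fixes w :: "'a::euclidean_space \<Rightarrow> real"
  assumes \<Omega>: "open \<Omega>" "bounded \<Omega>" and w: "smooth w" "supported_in \<Omega> w"
  obtains C where "\<And>v n. smooth v \<Longrightarrow> (\<And>x. \<bar>v x\<bar> \<le> 1) \<Longrightarrow>
    \<bar>\<integral>x. v x ^ n * (grad v x \<bullet> grad w x) \<partial>lebesgue_on \<Omega>\<bar> \<le> C / real (Suc n)"
proof -
  let ?M = "lebesgue_on \<Omega>"
  define L where "L x = (\<Sum>i\<in>Basis. partial_deriv i (partial_deriv i w) x)" for x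
  obtain K where K: "compact K" "K \<subseteq> \<Omega>" "\<And>x. x \<notin> K \<Longrightarrow> w x = 0"
    using w(2) by (auto simp: supported_in_def)
  have cL: "continuous_on UNIV L"
    unfolding L_def by (intro continuous_on_sum smooth_continuous smooth_partial_deriv w)
  note int = integrable_lebesgue_on_continuous[OF \<Omega>]
  have "\<bar>\<integral>x. v x ^ n * (grad v x \<bullet> grad w x) \<partial>?M\<bar> \<le> (\<integral>x. \<bar>L x\<bar> \<partial>?M) / real (Suc n)"
    if v: "smooth v" "\<And>x. \<bar>v x\<bar> \<le> 1" for v n
  proof -
    note cont = smooth_continuous[OF v(1)] continuous_on_grad[OF v(1)] continuous_on_grad[OF w(1)]
    let ?F = "\<lambda>i x. v x ^ Suc n * partial_deriv i w x"
    have F: "smooth (?F i)" if "i \<in> Basis" for i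
      using that by (intro smooth_mult smooth_power smooth_partial_deriv v w)
    have sF: "supported_in \<Omega> (?F i)" for i
      unfolding supported_in_def
    proof (intro exI[of _ K] conjI K allI impI)
      fix x assume "x \<notin> K"
      then show "?F i x = 0"
        using grad_eq_0_outside[of K w x] compact_imp_closed[OF K(1)] K(3) grad_inner_eq_partial_deriv[OF w(1), of x i]
        by simp
    qed
    have gF: "(\<Sum>i\<in>Basis. grad (?F i) x \<bullet> i)
        = real (Suc n) * (v x ^ n * (grad v x \<bullet> grad w x)) + v x ^ Suc n * L x" for x
    proof -
      have "grad (?F i) x \<bullet> i = real (Suc n) * v x ^ n * ((grad v x \<bullet> i) * (grad w x \<bullet> i))
          + v x ^ Suc n * partial_deriv i (partial_deriv i w) x" if i: "i \<in> Basis" for i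
        using i by (subst grad_mult)
          (simp_all add: smooth_power smooth_partial_deriv v w grad_power grad_inner_eq_partial_deriv
            inner_add_left del: power_Suc)
      then have "(\<Sum>i\<in>Basis. grad (?F i) x \<bullet> i)
          = (\<Sum>i\<in>Basis. real (Suc n) * v x ^ n * ((grad v x \<bullet> i) * (grad w x \<bullet> i))
            + v x ^ Suc n * partial_deriv i (partial_deriv i w) x)"
        by (rule sum.cong[OF refl])
      also have "\<dots> = real (Suc n) * v x ^ n * (grad v x \<bullet> grad w x) + v x ^ Suc n * L x"
        unfolding sum.distrib sum_distrib_left[symmetric] L_def euclidean_inner[of "grad v x" "grad w x"] ..
      finally show ?thesis by (simp only: mult.assoc)
    qed
    have i1: "integrable ?M (\<lambda>x. v x ^ n * (grad v x \<bullet> grad w x))"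
      by (intro int continuous_intros cont)
    have i2: "integrable ?M (\<lambda>x. v x ^ Suc n * L x)"
      by (intro int continuous_intros cont cL)
    have i3: "integrable ?M (\<lambda>x. \<bar>L x\<bar>)"
      by (intro int continuous_intros cont cL)
    have "0 = (\<Sum>i\<in>Basis. \<integral>x. grad (?F i) x \<bullet> i \<partial>?M)"
      by (rule sum.neutral[symmetric], rule ballI) (rule integral_derivative_supported[OF \<Omega>(1) F sF])
    also have "\<dots> = (\<integral>x. (\<Sum>i\<in>Basis. grad (?F i) x \<bullet> i) \<partial>?M)"
      by (rule Bochner_Integration.integral_sum[symmetric])
        (intro int continuous_on_inner continuous_on_grad F continuous_on_const)
    also have "\<dots> = real (Suc n) * (\<integral>x. v x ^ n * (grad v x \<bullet> grad w x) \<partial>?M)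
        + (\<integral>x. v x ^ Suc n * L x \<partial>?M)"
      unfolding gF using i1 i2 by (simp only: Bochner_Integration.integral_add integrable_mult_right
          integral_mult_right_zero)
    finally have "real (Suc n) * (\<integral>x. v x ^ n * (grad v x \<bullet> grad w x) \<partial>?M)
        = - (\<integral>x. v x ^ Suc n * L x \<partial>?M)" by linarith
    then have "real (Suc n) * \<bar>\<integral>x. v x ^ n * (grad v x \<bullet> grad w x) \<partial>?M\<bar>
        = \<bar>\<integral>x. v x ^ Suc n * L x \<partial>?M\<bar>"
      by (metis abs_minus_cancel abs_mult abs_of_nat)
    also have "\<dots> \<le> (\<integral>x. \<bar>v x ^ Suc n * L x\<bar> \<partial>?M)" by (rule integral_abs_bound)
    also have "\<dots> \<le> (\<integral>x. \<bar>L x\<bar> \<partial>?M)"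
    proof (rule integral_mono[OF integrable_abs[OF i2] i3])
      fix x
      have "\<bar>v x\<bar> ^ Suc n \<le> 1" by (rule power_le_one) (use v(2) in auto)
      then have "\<bar>v x\<bar> ^ Suc n * \<bar>L x\<bar> \<le> 1 * \<bar>L x\<bar>" by (intro mult_right_mono) auto
      then show "\<bar>v x ^ Suc n * L x\<bar> \<le> \<bar>L x\<bar>" by (simp only: abs_mult power_abs mult_1)
    qed
    finally show ?thesis by (simp add: field_simps)
  qed
  then show ?thesis using that by blast
qed

section \<open>The functional and the subdifferential at zero\<close>

lemma L2_eq: "L2 \<Omega> = {u. square_integrable (lebesgue_on \<Omega>) u}"
  by (simp add: L2_def square_integrable_def)

lemma L2_inner_eq: "L2_inner \<Omega> u v = ip (lebesgue_on \<Omega>) u v"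
  by (simp add: L2_inner_def ip_def)

lemma test_functions_uminus:
  assumes "v \<in> test_functions \<Omega>"
  shows "(\<lambda>x. (-1) * v x) \<in> test_functions \<Omega>"
  using assms supported_in_mono[of \<Omega> v "\<lambda>x. (-1) * v x"] smooth_mult[OF smooth_const, of v "-1"]
  by (simp add: test_functions_iff)

lemma test_functions_zero: "(\<lambda>x. 0) \<in> test_functions \<Omega>"
  by (auto simp: test_functions_iff smooth_const supported_in_def intro: exI[of _ "{}"])

lemma test_functions_convex:
  assumes v: "v \<in> test_functions \<Omega>" and w: "w \<in> test_functions \<Omega>" and t: "0 \<le> t" "t \<le> 1"
  shows "(\<lambda>x. v x + t * (w x - v x)) \<in> test_functions \<Omega>"
  unfolding test_functions_iff
proof (intro conjI allI)
  note vw = v[unfolded test_functions_iff] w[unfolded test_functions_iff]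
  show "smooth (\<lambda>x. v x + t * (w x - v x))"
    using vw by (intro smooth_add smooth_mult smooth_const smooth_diff) simp_all
  show "supported_in \<Omega> (\<lambda>x. v x + t * (w x - v x))"
    by (rule supported_in_Un[of \<Omega> v w]) (use vw in simp_all)
  fix x
  have "\<bar>(1 - t) * v x + t * w x\<bar> \<le> (1 - t) * \<bar>v x\<bar> + t * \<bar>w x\<bar>"
    using t by (intro order_trans[OF abs_triangle_ineq]) (simp add: abs_mult)
  also have "\<dots> \<le> (1 - t) * 1 + t * 1"
    using t vw by (intro add_mono mult_left_mono) simp_all
  finally show "\<bar>v x + t * (w x - v x)\<bar> \<le> 1" by (simp add: algebra_simps)
qed

lemma grad_square_integrable:
  assumes "open \<Omega>" "bounded \<Omega>" "v \<in> test_functions \<Omega>"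
  shows "square_integrable (lebesgue_on \<Omega>) (grad v)"
  using assms by (intro square_integrable_continuous continuous_on_grad) (simp_all add: test_functions_iff)

lemma total_div_upper:
  assumes "v \<in> test_functions \<Omega>"
  shows "ereal (ip (lebesgue_on \<Omega>) (grad v) u) \<le> total_div \<Omega> u"
proof -
  have "grad (\<lambda>x. (-1) * v x) x = (-1) *\<^sub>R grad v x" for x
    using assms by (intro grad_cmult) (simp add: test_functions_iff)
  then have "ereal (ip (lebesgue_on \<Omega>) (grad v) u)
      = ereal (- (\<integral>x. u x \<bullet> grad (\<lambda>x. (-1) * v x) x \<partial>lebesgue_on \<Omega>))"
    by (simp add: ip_def inner_commute)
  also have "\<dots> \<le> total_div \<Omega> u"
    unfolding total_div_def by (rule SUP_upper[OF test_functions_uminus[OF assms]])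
  finally show ?thesis .
qed

lemma total_div_least:
  assumes "\<And>v. v \<in> test_functions \<Omega> \<Longrightarrow> ip (lebesgue_on \<Omega>) (grad v) u \<le> c"
  shows "total_div \<Omega> u \<le> ereal c"
  unfolding total_div_def
proof (rule SUP_least)
  fix v assume v: "v \<in> test_functions \<Omega>"
  have "grad (\<lambda>x. (-1) * v x) x = (-1) *\<^sub>R grad v x" for x
    using v by (intro grad_cmult) (simp add: test_functions_iff)
  then show "ereal (- (\<integral>x. u x \<bullet> grad v x \<partial>lebesgue_on \<Omega>)) \<le> ereal c"
    using assms[OF test_functions_uminus[OF v]] by (simp add: ip_def inner_commute)
qed

text \<open>
  This is \<open>\<partial>J(0)\<close>, the closed convex set whose support function is \<open>J\<close>.
\<close>

definition dual_ball :: "(real ^ 'n::finite) set \<Rightarrow> 'n field set" where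
  "dual_ball \<Omega> = {p \<in> L2 \<Omega>. \<forall>z\<in>L2 \<Omega>. ereal (L2_inner \<Omega> p z) \<le> total_div \<Omega> z}"

lemma subdiff_eq_dual_ball:
  "p \<in> subdiff \<Omega> (total_div \<Omega>) u \<longleftrightarrow>
    p \<in> dual_ball \<Omega> \<and> ereal (L2_inner \<Omega> p u) = total_div \<Omega> u"
  by (auto simp: subdiff_def dual_ball_def)

lemma dual_ball_limit:
  assumes v: "\<And>k. v k \<in> test_functions \<Omega>"
    and lim: "L2_tendsto (lebesgue_on \<Omega>) (\<lambda>k. grad (v k)) q"
  shows "q \<in> dual_ball \<Omega>"
  unfolding dual_ball_def
proof (intro CollectI conjI ballI)
  show "q \<in> L2 \<Omega>" using lim by (simp add: L2_eq L2_tendsto_def)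
  fix z assume "z \<in> L2 \<Omega>"
  then have "L2_tendsto (lebesgue_on \<Omega>) (\<lambda>k. z) z" by (simp add: L2_eq L2_tendsto_const)
  from L2_tendsto_ip[OF lim this]
  have "(\<lambda>k. ereal (ip (lebesgue_on \<Omega>) (grad (v k)) z)) \<longlonglongrightarrow> ereal (L2_inner \<Omega> q z)"
    by (simp add: L2_inner_eq)
  then show "ereal (L2_inner \<Omega> q z) \<le> total_div \<Omega> z"
    by (rule LIMSEQ_le_const2) (use total_div_upper[OF v] in blast)
qed

text \<open>
  Since \<open>J\<close> is the support function of the gradients of test functions, Hilbert space separation
  makes every element of \<open>\<partial>J(0)\<close> a limit of such gradients. The Poincare inequality makes the
  potentials Cauchy, so they converge almost everywhere along a subsequence; their limit is the
  potential of the field.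
\<close>

lemma dual_ball_approximation:
  fixes p :: "'n::finite field"
  assumes \<Omega>: "open \<Omega>" "bounded \<Omega>" and p: "p \<in> dual_ball \<Omega>"
  obtains v V where "\<And>k. v k \<in> test_functions \<Omega>"
    "L2_tendsto (lebesgue_on \<Omega>) (\<lambda>k. grad (v k)) p"
    "V \<in> borel_measurable (lebesgue_on \<Omega>)"
    "AE x in lebesgue_on \<Omega>. (\<lambda>k. v k x) \<longlonglongrightarrow> V x"
proof -
  let ?M = "lebesgue_on \<Omega>"
  have sp: "square_integrable ?M p" using p by (simp add: dual_ball_def L2_eq)
  obtain g where g: "\<And>k. g k \<in> grad ` test_functions \<Omega>" and gp: "L2_tendsto ?M g p"
  proof (rule L2_closure_of_convex_set[of "grad ` test_functions \<Omega>" ?M p])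
    show "square_integrable ?M h" if "h \<in> grad ` test_functions \<Omega>" for h
      using that grad_square_integrable[OF \<Omega>] by blast
    show "grad ` test_functions \<Omega> \<noteq> {}" using test_functions_zero by blast
    show "(\<lambda>x. h x + t *\<^sub>R (h' x - h x)) \<in> grad ` test_functions \<Omega>"
      if h: "h \<in> grad ` test_functions \<Omega>" "h' \<in> grad ` test_functions \<Omega>" and t: "0 \<le> t" "t \<le> 1"
      for h h' t
    proof -
      obtain v w where vw: "v \<in> test_functions \<Omega>" "h = grad v" "w \<in> test_functions \<Omega>" "h' = grad w"
        using h by blast
      have s: "smooth v" "smooth w" using vw by (simp_all add: test_functions_iff)
      have "grad (\<lambda>x. v x + t * (w x - v x)) x = grad v x + t *\<^sub>R (grad w x - grad v x)" for x
        using s by (simp add: grad_add grad_cmult grad_diff smooth_mult smooth_const smooth_diff)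
      then have "(\<lambda>x. h x + t *\<^sub>R (h' x - h x)) = grad (\<lambda>x. v x + t * (w x - v x))"
        using vw by (simp add: fun_eq_iff)
      then show ?thesis using test_functions_convex[OF vw(1,3) t] by blast
    qed
    show "square_integrable ?M p" by (rule sp)
    show "ip ?M p z \<le> c" if z: "square_integrable ?M z"
      and c: "\<And>h. h \<in> grad ` test_functions \<Omega> \<Longrightarrow> ip ?M h z \<le> c" for z c
    proof -
      have "ereal (ip ?M p z) \<le> total_div \<Omega> z"
        using p z by (simp add: dual_ball_def L2_eq L2_inner_eq)
      also have "\<dots> \<le> ereal c" by (rule total_div_least) (use c in blast)
      finally show ?thesis by simp
    qed
  qed blast
  have "\<forall>k. \<exists>w. w \<in> test_functions \<Omega> \<and> g k = grad w" using g by blast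
  then obtain w where w: "\<And>k. w k \<in> test_functions \<Omega>" "\<And>k. g k = grad (w k)" by metis
  have sw: "smooth (w k)" "supported_in \<Omega> (w k)" for k
    using w(1) by (simp_all add: test_functions_iff)
  have siw: "square_integrable ?M (w k)" for k
    by (intro square_integrable_continuous \<Omega> smooth_continuous sw)
  obtain R where R: "\<And>x. x \<in> \<Omega> \<Longrightarrow> norm x \<le> R"
    using \<Omega>(2) unfolding bounded_iff by blast
  define e where "e k = ip ?M (\<lambda>x. g k x - p x) (\<lambda>x. g k x - p x)" for k
  have sg: "square_integrable ?M (\<lambda>x. g k x - p x)" for k
    using gp sp by (simp add: L2_tendsto_def)
  have bound: "ip ?M (\<lambda>x. w m x - w n x) (\<lambda>x. w m x - w n x) \<le> 8 * R\<^sup>2 * (e m + e n)" for m n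
  proof -
    have "ip ?M (\<lambda>x. w m x - w n x) (\<lambda>x. w m x - w n x)
        \<le> 4 * R\<^sup>2 * ip ?M (grad (\<lambda>x. w m x - w n x)) (grad (\<lambda>x. w m x - w n x))"
      by (intro Poincare_inequality \<Omega> R smooth_diff sw supported_in_Un[OF sw(2)[of m] sw(2)[of n]])
        simp_all
    also have "grad (\<lambda>x. w m x - w n x) = (\<lambda>x. (g m x - p x) - (g n x - p x))"
      using sw by (simp add: fun_eq_iff grad_diff w(2))
    also have "4 * R\<^sup>2 * ip ?M (\<lambda>x. (g m x - p x) - (g n x - p x)) (\<lambda>x. (g m x - p x) - (g n x - p x))
        \<le> 4 * R\<^sup>2 * (2 * e m + 2 * e n)"
      unfolding e_def parallelogram_L2[OF sg sg] by (intro mult_left_mono) simp_all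
    finally show ?thesis by (simp add: algebra_simps)
  qed
  have e0: "e \<longlonglongrightarrow> 0" using gp by (simp add: L2_tendsto_def e_def[abs_def])
  obtain r v where r: "strict_mono r" and v: "L2_tendsto ?M (\<lambda>k. w (r k)) v"
    "AE x in ?M. (\<lambda>k. w (r k) x) \<longlonglongrightarrow> v x"
  proof (rule L2_Cauchy_subsequence[of ?M w])
    fix \<epsilon> :: real assume \<epsilon>: "\<epsilon> > 0"
    define c where "c = \<epsilon> / (16 * R\<^sup>2 + 1)"
    have R1: "0 < 16 * R\<^sup>2 + 1" by (simp add: add_nonneg_pos)
    have c: "c > 0" "(16 * R\<^sup>2 + 1) * c = \<epsilon>" using \<epsilon> R1 by (simp_all add: c_def)
    from order_tendstoD(2)[OF e0 c(1)] obtain N where N: "\<And>k. k \<ge> N \<Longrightarrow> e k < c"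
      by (auto simp: eventually_sequentially)
    show "\<exists>N. \<forall>m\<ge>N. \<forall>n\<ge>N. ip ?M (\<lambda>x. w m x - w n x) (\<lambda>x. w m x - w n x) < \<epsilon>"
    proof (intro exI[of _ N] allI impI)
      fix m n assume "N \<le> m" "N \<le> n"
      then have "e m + e n \<le> 2 * c" using N[of m] N[of n] by simp
      then have "8 * R\<^sup>2 * (e m + e n) \<le> 8 * R\<^sup>2 * (2 * c)"
        by (intro mult_left_mono) simp_all
      also have "\<dots> < (16 * R\<^sup>2 + 1) * c" using c(1) by (simp add: algebra_simps)
      also have "\<dots> = \<epsilon>" by (rule c(2))
      finally show "ip ?M (\<lambda>x. w m x - w n x) (\<lambda>x. w m x - w n x) < \<epsilon>"
        using bound[of m n] by simp
    qed
  qed (rule siw)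
  show ?thesis
  proof (rule that[of "\<lambda>k. w (r k)" v])
    show "L2_tendsto ?M (\<lambda>k. grad (w (r k))) p"
      using gp LIMSEQ_subseq_LIMSEQ[OF _ r] unfolding L2_tendsto_def w(2) comp_def by blast
    show "v \<in> borel_measurable ?M" using v(1) by (simp add: L2_tendsto_def square_integrable_def)
  qed (use w(1) v(2) in simp_all)
qed

section \<open>Subgradients of minimal norm\<close>

text \<open>
  The potentials \<open>v\<^sub>k + t \<phi>\<^sub>k\<close> still take values in \<open>[-1,1]\<close> for all \<open>|t| \<le> 1\<close>, so \<open>p + t q\<close> lies in
  \<open>\<partial>J(0)\<close>. Both signs of \<open>t\<close> give \<open>\<langle>q, u\<rangle> = 0\<close>, since \<open>p\<close> maximises the pairing with \<open>u\<close>; so \<open>p + t q\<close> lies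
  in \<open>\<partial>J(u)\<close>, and \<open>t \<mapsto> \<parallel>p + t q\<parallel>\<^sup>2\<close> is minimal at \<open>t = 0\<close>. With \<open>p = \<nabla>v\<close> this says that \<open>v\<close> is harmonic
  where \<open>|v| < 1\<close>.
\<close>

lemma minimal_norm_orthogonality:
  fixes p u :: "'n::finite field"
  assumes u: "u \<in> L2 \<Omega>" and p: "p \<in> subdiff \<Omega> (total_div \<Omega>) u"
    and minimal: "\<forall>q\<in>subdiff \<Omega> (total_div \<Omega>) u. L2_norm \<Omega> p \<le> L2_norm \<Omega> q"
    and v: "\<And>k. v k \<in> test_functions \<Omega>"
    and vp: "L2_tendsto (lebesgue_on \<Omega>) (\<lambda>k. grad (v k)) p"
    and \<phi>: "\<And>k. smooth (\<phi> k)" "\<And>k. supported_in \<Omega> (\<phi> k)" "\<And>k x. \<bar>\<phi> k x\<bar> \<le> 1 - \<bar>v k x\<bar>"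
    and \<phi>q: "L2_tendsto (lebesgue_on \<Omega>) (\<lambda>k. grad (\<phi> k)) q"
  shows "ip (lebesgue_on \<Omega>) p q = 0"
proof -
  let ?M = "lebesgue_on \<Omega>"
  have si: "square_integrable ?M p" "square_integrable ?M q" "square_integrable ?M u"
    using vp \<phi>q u by (simp_all add: L2_tendsto_def L2_eq)
  have ball: "(\<lambda>x. p x + t *\<^sub>R q x) \<in> dual_ball \<Omega>" if t: "\<bar>t\<bar> \<le> 1" for t
  proof (rule dual_ball_limit)
    fix k
    have sv: "smooth (v k)" "supported_in \<Omega> (v k)" using v[of k] by (simp_all add: test_functions_iff)
    show "(\<lambda>x. v k x + t * \<phi> k x) \<in> test_functions \<Omega>"
      unfolding test_functions_iff
    proof (intro conjI allI)
      show "smooth (\<lambda>x. v k x + t * \<phi> k x)"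
        by (intro smooth_add smooth_mult smooth_const sv \<phi>)
      show "supported_in \<Omega> (\<lambda>x. v k x + t * \<phi> k x)"
        by (rule supported_in_Un[OF sv(2) \<phi>(2)[of k]]) simp
      fix x
      have "\<bar>t\<bar> * \<bar>\<phi> k x\<bar> \<le> 1 * \<bar>\<phi> k x\<bar>" using t by (intro mult_right_mono) auto
      then show "\<bar>v k x + t * \<phi> k x\<bar> \<le> 1"
        using \<phi>(3)[of k x] abs_triangle_ineq[of "v k x" "t * \<phi> k x"] by (simp add: abs_mult)
    qed
  next
    have "grad (\<lambda>x. v k x + t * \<phi> k x) = (\<lambda>x. grad (v k) x + t *\<^sub>R grad (\<phi> k) x)" for k
      using v[of k] \<phi>(1)[of k]
      by (simp add: fun_eq_iff test_functions_iff grad_add grad_cmult smooth_mult smooth_const)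
    then show "L2_tendsto ?M (\<lambda>k. grad (\<lambda>x. v k x + t * \<phi> k x)) (\<lambda>x. p x + t *\<^sub>R q x)"
      using L2_tendsto_add[OF vp L2_tendsto_scaleR[OF \<phi>q]] by simp
  qed
  have Ju: "total_div \<Omega> u = ereal (ip ?M p u)"
    using p by (simp add: subdiff_eq_dual_ball L2_inner_eq)
  have ipt: "ip ?M (\<lambda>x. p x + t *\<^sub>R q x) u = ip ?M p u + t * ip ?M q u" for t
    using si by (simp add: ip_add_left ip_scaleR_left)
  have "ip ?M p u + t * ip ?M q u \<le> ip ?M p u" if "\<bar>t\<bar> \<le> 1" for t
    using ball[OF that] u by (auto simp: dual_ball_def Ju L2_inner_eq ipt)
  from this[of 1] this[of "-1"] have qu: "ip ?M q u = 0" by simp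
  have quad: "0 \<le> 2 * t * ip ?M p q + t\<^sup>2 * ip ?M q q" if t: "\<bar>t\<bar> \<le> 1" for t
  proof -
    have "(\<lambda>x. p x + t *\<^sub>R q x) \<in> subdiff \<Omega> (total_div \<Omega>) u"
      using ball[OF t] by (simp add: subdiff_eq_dual_ball Ju L2_inner_eq ipt qu)
    from bspec[OF minimal this] show ?thesis
      using si by (simp add: L2_norm_def L2_inner_eq ip_add_scaleR_self)
  qed
  show ?thesis
  proof (rule ccontr)
    assume "ip ?M p q \<noteq> 0"
    define b c where "b = ip ?M p q" and "c = ip ?M q q"
    \<comment> \<open>A step short enough for the linear term to dominate the quadratic one.\<close>
    define s where "s = \<bar>b\<bar> / (\<bar>b\<bar> + c + 1)"
    have b: "b \<noteq> 0" and c: "0 \<le> c" using \<open>ip ?M p q \<noteq> 0\<close> by (simp_all add: b_def c_def)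
    have s: "0 < s" "s \<le> 1" "s * c < \<bar>b\<bar>" using b c by (simp_all add: s_def field_simps add_pos_nonneg)
    have "0 \<le> 2 * (- sgn b * s) * b + (- sgn b * s)\<^sup>2 * c"
      unfolding b_def c_def by (rule quad) (use s in \<open>simp add: abs_mult abs_sgn_eq\<close>)
    also have "\<dots> = s * (s * c - 2 * \<bar>b\<bar>)"
      using b by (simp add: sgn_if power2_eq_square algebra_simps)
    also have "\<dots> < 0" using s by (simp add: mult_pos_neg)
    finally show False by simp
  qed
qed

text \<open>
  Bernoulli's inequality; it makes \<open>w (1 - v\<^sup>N) / N\<close> an admissible perturbation of \<open>v\<close> when \<open>|w| \<le> 1\<close>.
\<close>

lemma one_minus_power_le:
  fixes s :: real
  assumes "\<bar>s\<bar> \<le> 1" "even N"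
  shows "0 \<le> 1 - s ^ N" "1 - s ^ N \<le> real N * (1 - \<bar>s\<bar>)"
proof -
  have eq: "s ^ N = \<bar>s\<bar> ^ N" using assms(2) by (simp add: power_even_abs)
  then show "0 \<le> 1 - s ^ N" using assms(1) by (simp add: power_le_one)
  show "1 - s ^ N \<le> real N * (1 - \<bar>s\<bar>)"
    unfolding eq using Bernoulli_inequality[of "\<bar>s\<bar> - 1" N] by (simp add: algebra_simps)
qed

text \<open>
  Orthogonality for the perturbation \<open>\<phi> = w (1 - v\<^sup>N) / N\<close>, written out with the product rule; here \<open>V\<close>,
  \<open>W\<close> are the limits of the potentials and \<open>p\<close>, \<open>q\<close> the limits of their gradients. It is used for a
  fixed test function \<open>w\<close> and for \<open>w = v\<close>; the latter is a test function only before the limit, so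
  \<open>w\<close> is given by a sequence as well.
\<close>

lemma minimal_norm_variation:
  fixes p u :: "'n::finite field"
  assumes \<Omega>: "open \<Omega>" "bounded \<Omega>"
    and u: "u \<in> L2 \<Omega>" and p: "p \<in> subdiff \<Omega> (total_div \<Omega>) u"
    and minimal: "\<forall>q\<in>subdiff \<Omega> (total_div \<Omega>) u. L2_norm \<Omega> p \<le> L2_norm \<Omega> q"
    and v: "\<And>k. v k \<in> test_functions \<Omega>"
    and vp: "L2_tendsto (lebesgue_on \<Omega>) (\<lambda>k. grad (v k)) p"
    and vm: "V \<in> borel_measurable (lebesgue_on \<Omega>)"
    and vlim: "AE x in lebesgue_on \<Omega>. (\<lambda>k. v k x) \<longlonglongrightarrow> V x"
    and N: "even N" "N > 0"
    and w: "\<And>k. w k \<in> test_functions \<Omega>"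
    and wq: "L2_tendsto (lebesgue_on \<Omega>) (\<lambda>k. grad (w k)) q"
    and wm: "W \<in> borel_measurable (lebesgue_on \<Omega>)"
    and wlim: "AE x in lebesgue_on \<Omega>. (\<lambda>k. w k x) \<longlonglongrightarrow> W x"
  shows "ip (lebesgue_on \<Omega>) q p = ip (lebesgue_on \<Omega>) (\<lambda>x. V x ^ N *\<^sub>R q x) p
      + real N * ip (lebesgue_on \<Omega>) (\<lambda>x. (W x * V x ^ (N - 1)) *\<^sub>R p x) p"
proof -
  let ?M = "lebesgue_on \<Omega>"
  have sv: "smooth (v k)" "supported_in \<Omega> (v k)" "\<bar>v k x\<bar> \<le> 1" for k x
    using v[of k] by (simp_all add: test_functions_iff)
  have sw: "smooth (w k)" "supported_in \<Omega> (w k)" "\<bar>w k x\<bar> \<le> 1" for k x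
    using w[of k] by (simp_all add: test_functions_iff)
  note meas = borel_measurable_lebesgue_on_continuous[OF smooth_continuous]
  have vpow: "\<bar>v k x ^ n\<bar> \<le> 1" for k x n
    using power_le_one[of "\<bar>v k x\<bar>" n] sv(3)[of k x] by (simp add: power_abs)
  have A: "L2_tendsto ?M (\<lambda>k x. v k x ^ N *\<^sub>R grad (w k) x) (\<lambda>x. V x ^ N *\<^sub>R q x)"
  proof (rule L2_tendsto_bounded_scaleR[OF wq, where B=1])
    show "AE x in ?M. (\<lambda>k. v k x ^ N) \<longlonglongrightarrow> V x ^ N"
      using vlim by eventually_elim (rule tendsto_power)
  qed (use vm vpow in \<open>auto intro!: meas smooth_power sv\<close>)
  have B: "L2_tendsto ?M (\<lambda>k x. (w k x * v k x ^ (N - 1)) *\<^sub>R grad (v k) x)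
      (\<lambda>x. (W x * V x ^ (N - 1)) *\<^sub>R p x)"
  proof (rule L2_tendsto_bounded_scaleR[OF vp, where B=1])
    show "AE x in ?M. (\<lambda>k. w k x * v k x ^ (N - 1)) \<longlonglongrightarrow> W x * V x ^ (N - 1)"
      using vlim wlim by eventually_elim (intro tendsto_mult tendsto_power)
    have "\<bar>w k x * v k x ^ (N - 1)\<bar> \<le> 1" for k x
      unfolding abs_mult by (intro mult_le_one sw vpow) simp
    then show "AE x in ?M. \<bar>w k x * v k x ^ (N - 1)\<bar> \<le> 1" for k by simp
  qed (use vm wm in \<open>auto intro!: meas smooth_power smooth_mult sv sw\<close>)
  define q' where "q' x = (1 / real N) *\<^sub>R (q x + (-1) *\<^sub>R (V x ^ N *\<^sub>R q x
      + real N *\<^sub>R (W x * V x ^ (N - 1)) *\<^sub>R p x))" for x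
  define \<phi> where "\<phi> k x = (1 / real N) * (w k x * (1 - v k x ^ N))" for k and x :: "real ^ 'n"
  have grad\<phi>: "grad (\<phi> k) = (\<lambda>x. (1 / real N) *\<^sub>R (grad (w k) x + (-1) *\<^sub>R (v k x ^ N *\<^sub>R grad (w k) x
      + real N *\<^sub>R (w k x * v k x ^ (N - 1)) *\<^sub>R grad (v k) x)))" for k
  proof
    fix x :: "real ^ 'n"
    have c: "grad (\<lambda>x. 1) x = 0" by (rule grad_eqI) simp
    have "grad (\<phi> k) x = (1 / real N) *\<^sub>R ((1 - v k x ^ N) *\<^sub>R grad (w k) x
        + w k x *\<^sub>R (0 - (real N * v k x ^ (N - 1)) *\<^sub>R grad (v k) x))"
      unfolding \<phi>_def[abs_def]
      by (simp only: grad_cmult grad_mult grad_diff grad_power c smooth_mult smooth_diff smooth_const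
          smooth_power sv sw)
    then show "grad (\<phi> k) x = (1 / real N) *\<^sub>R (grad (w k) x + (-1) *\<^sub>R (v k x ^ N *\<^sub>R grad (w k) x
      + real N *\<^sub>R (w k x * v k x ^ (N - 1)) *\<^sub>R grad (v k) x))"
      by (simp add: algebra_simps)
  qed
  have \<phi>q: "L2_tendsto ?M (\<lambda>k. grad (\<phi> k)) q'"
    unfolding grad\<phi> q'_def[abs_def]
    by (intro L2_tendsto_scaleR L2_tendsto_add wq A B)
  have "ip ?M p q' = 0"
  proof (rule minimal_norm_orthogonality[OF u p minimal v vp _ _ _ \<phi>q])
    fix k x
    show "smooth (\<phi> k)" unfolding \<phi>_def[abs_def]
      by (intro smooth_mult smooth_const smooth_diff smooth_power sv sw)
    show "supported_in \<Omega> (\<phi> k)" by (rule supported_in_mono[OF sw(2)[of k]]) (simp add: \<phi>_def)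
    note h = one_minus_power_le[OF sv(3)[of k x] N(1)]
    have "\<bar>\<phi> k x\<bar> = (1 / real N) * (\<bar>w k x\<bar> * (1 - v k x ^ N))"
      using h(1) by (simp add: \<phi>_def abs_mult)
    also have "\<dots> \<le> (1 / real N) * (1 * (real N * (1 - \<bar>v k x\<bar>)))"
      by (intro mult_left_mono mult_mono sw h) (use h(1) in simp_all)
    also have "\<dots> = 1 - \<bar>v k x\<bar>" using N(2) by simp
    finally show "\<bar>\<phi> k x\<bar> \<le> 1 - \<bar>v k x\<bar>" .
  qed
  moreover have si: "square_integrable ?M p" "square_integrable ?M q"
    "square_integrable ?M (\<lambda>x. V x ^ N *\<^sub>R q x)"
    "square_integrable ?M (\<lambda>x. (W x * V x ^ (N - 1)) *\<^sub>R p x)"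
    using vp wq A B by (simp_all only: L2_tendsto_def)
  have "ip ?M q' p = (1 / real N) * (ip ?M q p + (-1) * (ip ?M (\<lambda>x. V x ^ N *\<^sub>R q x) p
      + real N * ip ?M (\<lambda>x. (W x * V x ^ (N - 1)) *\<^sub>R p x) p))"
    unfolding q'_def[abs_def]
    by (simp only: ip_scaleR_left ip_add_left si square_integrable_add square_integrable_scaleR)
  ultimately show ?thesis using N(2) by (simp add: ip_commute[of ?M p q'])
qed

text \<open>
  As \<open>p\<close> lies in \<open>\<partial>J(0)\<close>, being an eigenvector means \<open>J(p) \<le> \<parallel>p\<parallel>\<^sup>2\<close>, that is \<open>\<langle>\<nabla>w, p\<rangle> \<le> \<parallel>p\<parallel>\<^sup>2\<close> for all test
  functions \<open>w\<close>. The variation identity expresses the left side by integrals weighted with powers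
  of \<open>V\<close>; the identity for \<open>w = v\<close> computes the weights exactly.
\<close>

lemma minimal_norm_subgradient_is_eigenvector:
  fixes p u :: "'n::finite field"
  assumes \<Omega>: "open \<Omega>" "bounded \<Omega>"
    and u: "u \<in> L2 \<Omega>" and p: "p \<in> subdiff \<Omega> (total_div \<Omega>) u"
    and minimal: "\<forall>q\<in>subdiff \<Omega> (total_div \<Omega>) u. L2_norm \<Omega> p \<le> L2_norm \<Omega> q"
  shows "p \<in> subdiff \<Omega> (total_div \<Omega>) p"
proof -
  let ?M = "lebesgue_on \<Omega>"
  have ball: "p \<in> dual_ball \<Omega>" using p by (simp add: subdiff_eq_dual_ball)
  then have pL2: "p \<in> L2 \<Omega>" by (simp add: dual_ball_def)
  obtain v V where v: "\<And>k. v k \<in> test_functions \<Omega>"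
    and vp: "L2_tendsto ?M (\<lambda>k. grad (v k)) p"
    and V: "V \<in> borel_measurable ?M" "AE x in ?M. (\<lambda>k. v k x) \<longlonglongrightarrow> V x"
    using dual_ball_approximation[OF \<Omega> ball] by blast
  have sv: "smooth (v k)" "\<bar>v k x\<bar> \<le> 1" for k x
    using v[of k] by (simp_all add: test_functions_iff)
  note meas = borel_measurable_lebesgue_on_continuous[OF smooth_continuous]
  note variation = minimal_norm_variation[OF \<Omega> u p minimal v vp V]
  have vpow: "\<bar>v k x ^ n\<bar> \<le> 1" for k x n
    using power_le_one[of "\<bar>v k x\<bar>" n] sv(2)[of k x] by (simp add: power_abs)
  have pow: "L2_tendsto ?M (\<lambda>k x. v k x ^ n *\<^sub>R g x) (\<lambda>x. V x ^ n *\<^sub>R g x)"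
    if "square_integrable ?M g" for n and g :: "'n field"
  proof (rule L2_tendsto_bounded_scaleR[OF L2_tendsto_const[OF that], where B=1])
    show "AE x in ?M. (\<lambda>k. v k x ^ n) \<longlonglongrightarrow> V x ^ n"
      using V(2) by eventually_elim (rule tendsto_power)
    show "(\<lambda>x. v k x ^ n) \<in> borel_measurable ?M" for k by (intro meas smooth_power sv)
    show "(\<lambda>x. V x ^ n) \<in> borel_measurable ?M" using V(1) by measurable
  qed (simp add: vpow)
  have sp: "square_integrable ?M p" using pL2 by (simp add: L2_eq)
  have sVp: "square_integrable ?M (\<lambda>x. V x ^ n *\<^sub>R p x)" for n
    using pow[OF sp] by (simp add: L2_tendsto_def)
  define E where "E n = ip ?M (\<lambda>x. V x ^ n *\<^sub>R p x) p" for n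
  \<comment> \<open>The variation identity with \<open>w = v\<close>.\<close>
  have E: "E n = ip ?M p p / real (n + 1)" if n: "even n" for n
  proof (cases "n = 0")
    case False
    then have "V x * V x ^ (n - 1) = V x ^ n" for x by (simp add: power_eq_if)
    then have "ip ?M p p = E n + real n * E n"
      using variation[OF n _ v vp V] False by (simp add: E_def)
    then show ?thesis by (simp add: field_simps)
  qed (simp add: E_def)
  have key: "ip ?M (grad w) p \<le> ip ?M p p" if w: "w \<in> test_functions \<Omega>" for w
  proof -
    have sw: "smooth w" "supported_in \<Omega> w" "\<bar>w x\<bar> \<le> 1" for x
      using w by (simp_all add: test_functions_iff)
    have gw: "square_integrable ?M (grad w)" by (rule grad_square_integrable[OF \<Omega> w])
    obtain C where C: "\<And>v n. smooth v \<Longrightarrow> (\<And>x. \<bar>v x\<bar> \<le> 1) \<Longrightarrow>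
        \<bar>\<integral>x. v x ^ n * (grad v x \<bullet> grad w x) \<partial>?M\<bar> \<le> C / real (Suc n)"
      using integral_power_grad_bound[OF \<Omega> sw(1,2)] by blast
    have "ip ?M (grad w) p \<le> ip ?M p p + (ip ?M p p + \<bar>C\<bar>) * inverse (real (Suc m))" for m
    proof -
      \<comment> \<open>Even, so that the weights \<open>V\<^sup>N\<close> are nonnegative, and at least 2, so that \<open>N - 2 = 2 m\<close>.\<close>
      define N where "N = 2 * Suc m"
      have N: "even N" "N > 0" by (simp_all add: N_def)
      have "(\<lambda>k. ip ?M (\<lambda>x. v k x ^ N *\<^sub>R grad w x) (grad (v k)))
          \<longlonglongrightarrow> ip ?M (\<lambda>x. V x ^ N *\<^sub>R grad w x) p"
        by (rule L2_tendsto_ip[OF pow[OF gw] vp])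
      moreover have "ip ?M (\<lambda>x. v k x ^ N *\<^sub>R grad w x) (grad (v k)) \<le> C / real (Suc N)" for k
        using C[OF sv, of k N] by (simp add: ip_def inner_commute)
      ultimately have first: "ip ?M (\<lambda>x. V x ^ N *\<^sub>R grad w x) p \<le> C / real (Suc N)"
        by (intro LIMSEQ_le_const2) auto
      have sB: "square_integrable ?M (\<lambda>x. w x *\<^sub>R (V x ^ (N - 1) *\<^sub>R p x))"
        by (rule square_integrable_bounded_scaleR[OF meas[OF sw(1)] _ sVp, of 1]) (simp add: sw)
      have "ip ?M (\<lambda>x. (w x * V x ^ (N - 1)) *\<^sub>R p x) p
          \<le> ip ?M (\<lambda>x. (1/2) *\<^sub>R (V x ^ (2 * m) *\<^sub>R p x + V x ^ N *\<^sub>R p x)) p"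
        unfolding ip_def
      proof (rule integral_mono)
        show "integrable ?M (\<lambda>x. (w x * V x ^ (N - 1)) *\<^sub>R p x \<bullet> p x)"
          using integrable_inner_L2[OF sB sp] by simp
        show "integrable ?M (\<lambda>x. ((1/2) *\<^sub>R (V x ^ (2 * m) *\<^sub>R p x + V x ^ N *\<^sub>R p x)) \<bullet> p x)"
          by (intro integrable_inner_L2 square_integrable_scaleR square_integrable_add sVp sp)
        fix x
        \<comment> \<open>\<open>2 w V \<le> 1 + V\<^sup>2\<close> trades the odd power of \<open>V\<close> for the two neighbouring even ones.\<close>
        have "2 * w x * V x \<le> (w x)\<^sup>2 + (V x)\<^sup>2" by (rule sum_squares_bound)
        also have "(w x)\<^sup>2 \<le> 1" using sw(3)[of x] by (simp add: abs_square_le_1)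
        finally have "V x ^ (2 * m) * (2 * w x * V x) \<le> V x ^ (2 * m) * (1 + (V x)\<^sup>2)"
          by (intro mult_left_mono) simp_all
        then have "w x * V x ^ (N - 1) \<le> (1/2) * (V x ^ (2 * m) + V x ^ N)"
          by (simp add: N_def power2_eq_square algebra_simps)
        then have "w x * V x ^ (N - 1) * (p x \<bullet> p x)
            \<le> (1/2) * (V x ^ (2 * m) + V x ^ N) * (p x \<bullet> p x)"
          by (intro mult_right_mono) simp_all
        then show "(w x * V x ^ (N - 1)) *\<^sub>R p x \<bullet> p x
            \<le> ((1/2) *\<^sub>R (V x ^ (2 * m) *\<^sub>R p x + V x ^ N *\<^sub>R p x)) \<bullet> p x"
          by (simp add: inner_add_left algebra_simps)
      qed
      also have "\<dots> = (1/2) * (E (2 * m) + E N)"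
        unfolding E_def by (simp only: ip_scaleR_left ip_add_left sVp sp)
      finally have "real N * ip ?M (\<lambda>x. (w x * V x ^ (N - 1)) *\<^sub>R p x) p
          \<le> real N * ((1/2) * (E (2 * m) + E N))"
        by (intro mult_left_mono) simp_all
      also have "\<dots> = ip ?M p p * (real (Suc m) / real (2 * m + 1) + real (Suc m) / real (N + 1))"
      proof -
        have "real N * ((1/2) * (E (2 * m) + E N)) = real (Suc m) * (E (2 * m) + E N)"
          by (simp add: N_def)
        then show ?thesis
          using E[of "2 * m"] E[OF N(1)] by (simp add: distrib_left mult.commute del: of_nat_Suc of_nat_add)
      qed
      also have "\<dots> \<le> ip ?M p p * ((1/2 + inverse (real (Suc m))) + 1/2)"
        by (intro mult_left_mono add_mono) (simp_all add: N_def field_simps)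
      finally have second: "real N * ip ?M (\<lambda>x. (w x * V x ^ (N - 1)) *\<^sub>R p x) p
          \<le> ip ?M p p + ip ?M p p * inverse (real (Suc m))" by (simp add: algebra_simps)
      have "C / real (Suc N) \<le> \<bar>C\<bar> * inverse (real (Suc m))"
        unfolding divide_inverse by (intro mult_mono le_imp_inverse_le) (simp_all add: N_def)
      moreover have "ip ?M (grad w) p = ip ?M (\<lambda>x. V x ^ N *\<^sub>R grad w x) p
          + real N * ip ?M (\<lambda>x. (w x * V x ^ (N - 1)) *\<^sub>R p x) p"
        by (rule variation[OF N, where w="\<lambda>_. w"])
          (simp_all add: w L2_tendsto_const gw meas sw)
      ultimately show ?thesis using first second by (simp add: algebra_simps)
    qed
    moreover have "(\<lambda>m. ip ?M p p + (ip ?M p p + \<bar>C\<bar>) * inverse (real (Suc m)))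
        \<longlonglongrightarrow> ip ?M p p + (ip ?M p p + \<bar>C\<bar>) * 0"
      by (intro tendsto_intros LIMSEQ_inverse_real_of_nat)
    ultimately show ?thesis by (intro LIMSEQ_le_const) auto
  qed
  have "total_div \<Omega> p \<le> ereal (L2_inner \<Omega> p p)"
    unfolding L2_inner_eq by (rule total_div_least) (rule key)
  moreover have "ereal (L2_inner \<Omega> p p) \<le> total_div \<Omega> p"
    using ball pL2 by (simp add: dual_ball_def)
  ultimately show ?thesis using ball by (simp add: subdiff_eq_dual_ball)
qed

theorem theorem5p15:
  fixes \<Omega> :: "(real ^ 'n::finite) set"
    and f :: "real ^ 'n \<Rightarrow> real ^ 'n"
    and u p :: "real \<Rightarrow> real ^ 'n \<Rightarrow> real ^ 'n"
  assumes "CARD('n) \<ge> 2"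
    and "open \<Omega>" and "bounded \<Omega>"
    and "f \<in> L2_closure \<Omega> (dom_subdiff \<Omega> (total_div \<Omega>))"
    and "gradient_flow \<Omega> (total_div \<Omega>) f u p"
  shows "\<forall>t>0. p t \<in> subdiff \<Omega> (total_div \<Omega>) (p t)"
proof (intro allI impI)
  fix t :: real assume t: "t > 0"
  show "p t \<in> subdiff \<Omega> (total_div \<Omega>) (p t)"
  proof (rule minimal_norm_subgradient_is_eigenvector[OF assms(2,3)])
    show "u t \<in> L2 \<Omega>" "p t \<in> subdiff \<Omega> (total_div \<Omega>) (u t)"
      "\<forall>q\<in>subdiff \<Omega> (total_div \<Omega>) (u t). L2_norm \<Omega> (p t) \<le> L2_norm \<Omega> q"
      using assms(5) t by (simp_all add: gradient_flow_def)
  qed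
qed

end
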